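(* Let $v_1,\ldots,v_m\in\mathbb{R}^d$ and let $k\ge d$ be an integer. Let $x\in\mathbb{R}^m_{\ge 0}$ be an optimal solution of the D-design convex relaxation \[ \text{minimize } \det\Big(\sum_{i=1}^m x(i)\,v_iv_i^\top\Big)^{-1/d}\quad\text{subject to}\quad \sum_{i=1}^m x(i)\le k,\ x(i)\ge 0\ (i\in[m]), \] normalized so that $\sum_{i=1}^m x(i)=k$, and let $X=\sum_{i=1}^m x(i)v_iv_i^\top$. There is a deterministic rounding algorithm (based on the method of interlacing polynomials) that, given $v_1,\ldots,v_m$, $k$ and $x$, outputs $(s_1,\ldots,s_k)\in[m]^k$ (a multiset of $k$ of the vectors, repetitions allowed) with \[ \det\Big(\sum_{j=1}^k v_{s_j}v_{s_j}^\top\Big)\ \ge\ \frac{k!}{(k-d)!\,k^d}\,\det(X), \] so that $\det\big(\sum_{j} v_{s_j}v_{s_j}^\top\big)^{-1/d}\le k\cdot\big((k-d)!/k!\big)^{1/d}\det(X)^{-1/d}$. In particular this is a $k\cdot((k-d)!/k!)^{1/d}$-approximation algorithm for D-design (choosing a multiset $S$ of $k$ of the vectors minimizing $\det(\sum_{i\in S}v_iv_i^\top)^{-1/d}$). The rounding algorithm runs in $O(kmd^{\omega+1})$ time, where $\omega$ is the matrix-multiplication exponent.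
   Context: Solutions are multisets (selection with repetitions allowed). *)

theory Defs
  imports
    Complex_Main
    "HOL-Library.Multiset"
    "HOL-Library.Extended_Real"
    "HOL-Library.More_List"
    "Jordan_Normal_Form.Determinant"
begin

section \<open>D-design and its convex relaxation\<close>

text \<open>The vectors are \<open>v 0, \<dots>, v (m - 1)\<close>, so indices range over \<open>{..<m}\<close>.  The first
  matrix is \<open>\<Sum>i<m. x(i) v\<^sub>i v\<^sub>i\<^sup>T\<close>, the second one \<open>\<Sum>i\<in>S. v\<^sub>i v\<^sub>i\<^sup>T\<close> with multiplicities, both
  written entrywise because matrices of different sizes share one type.\<close>

definition weighted_gram :: "nat \<Rightarrow> nat \<Rightarrow> (nat \<Rightarrow> real vec) \<Rightarrow> real vec \<Rightarrow> real mat" where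
  "weighted_gram d m v x = mat d d (\<lambda>(a, b). \<Sum>i<m. x $ i * (v i $ a * v i $ b))"

definition multiset_gram :: "nat \<Rightarrow> (nat \<Rightarrow> real vec) \<Rightarrow> nat multiset \<Rightarrow> real mat" where
  "multiset_gram d v S = mat d d (\<lambda>(a, b). \<Sum>i\<in>#S. v i $ a * v i $ b)"

text \<open>The objective \<open>det(A)\<^bsup>-1/d\<^esup>\<close>.  All matrices it is applied to are positive semidefinite; a
  singular one has objective \<open>\<infinity>\<close>, whereas \<^term>\<open>0 powr a\<close> would be 0.\<close>

definition D_objective :: "nat \<Rightarrow> real mat \<Rightarrow> ereal" where
  "D_objective d A = (if det A > 0 then ereal (det A powr (- 1 / real d)) else \<infinity>)"

definition relaxation_feasible :: "nat \<Rightarrow> nat \<Rightarrow> real vec \<Rightarrow> bool" where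
  "relaxation_feasible m k x \<longleftrightarrow>
     x \<in> carrier_vec m \<and> (\<Sum>i<m. x $ i) \<le> real k \<and> (\<forall>i<m. 0 \<le> x $ i)"

definition relaxation_optimal ::
  "nat \<Rightarrow> nat \<Rightarrow> nat \<Rightarrow> (nat \<Rightarrow> real vec) \<Rightarrow> real vec \<Rightarrow> bool" where
  "relaxation_optimal d m k v x \<longleftrightarrow> relaxation_feasible m k x \<and>
     (\<forall>y. relaxation_feasible m k y \<longrightarrow>
        D_objective d (weighted_gram d m v x) \<le> D_objective d (weighted_gram d m v y))"

definition D_design_solutions :: "nat \<Rightarrow> nat \<Rightarrow> nat multiset set" where
  "D_design_solutions m k = {S. size S = k \<and> set_mset S \<subseteq> {..<m}}"

definition D_design_opt :: "nat \<Rightarrow> nat \<Rightarrow> nat \<Rightarrow> (nat \<Rightarrow> real vec) \<Rightarrow> ereal" where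
  "D_design_opt d m k v = (INF S\<in>D_design_solutions m k. D_objective d (multiset_gram d v S))"


section \<open>Real RAM programs\<close>

text \<open>A program is a finite text working on two kinds of unbounded two-dimensional arrays, of
  natural numbers and of reals; a scalar variable is the entry at (0, 0).  Natural numbers
  (used for indices, counters and the output) admit only addition and truncated subtraction, reals
  the four field operations and exact comparison.  There is no rounding or other passage from reals
  to natural numbers, and no real constants other than natural numbers.  The running time charges
  one unit for every constant, memory access, operation, test, assignment and loop
  iteration.\<close>

type_synonym name = string
type_synonym state = "(name \<Rightarrow> nat \<Rightarrow> nat \<Rightarrow> nat) \<times> (name \<Rightarrow> nat \<Rightarrow> nat \<Rightarrow> real)"

datatype nexp =
    NConst nat
  | NGet name nexp nexp
  | NAdd nexp nexp
  | NSub nexp nexp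

datatype rexp =
    OfNat nexp
  | RGet name nexp nexp
  | RAdd rexp rexp
  | RSub rexp rexp
  | RMul rexp rexp
  | RDiv rexp rexp

datatype bexp =
    NLess nexp nexp
  | RLess rexp rexp
  | BNot bexp
  | BAnd bexp bexp

datatype com =
    Skip
  | NPut name nexp nexp nexp
  | RPut name nexp nexp rexp
  | Seq com com
  | Cond bexp com com
  | While bexp com

primrec nval :: "nexp \<Rightarrow> state \<Rightarrow> nat" where
  "nval (NConst n) s = n"
| "nval (NGet a i j) s = fst s a (nval i s) (nval j s)"
| "nval (NAdd e f) s = nval e s + nval f s"
| "nval (NSub e f) s = nval e s - nval f s"

primrec rval :: "rexp \<Rightarrow> state \<Rightarrow> real" where
  "rval (OfNat e) s = real (nval e s)"
| "rval (RGet a i j) s = snd s a (nval i s) (nval j s)"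
| "rval (RAdd e f) s = rval e s + rval f s"
| "rval (RSub e f) s = rval e s - rval f s"
| "rval (RMul e f) s = rval e s * rval f s"
| "rval (RDiv e f) s = rval e s / rval f s"

primrec bval :: "bexp \<Rightarrow> state \<Rightarrow> bool" where
  "bval (NLess e f) s \<longleftrightarrow> nval e s < nval f s"
| "bval (RLess e f) s \<longleftrightarrow> rval e s < rval f s"
| "bval (BNot b) s \<longleftrightarrow> \<not> bval b s"
| "bval (BAnd b c) s \<longleftrightarrow> bval b s \<and> bval c s"

primrec ncost :: "nexp \<Rightarrow> nat" where
  "ncost (NConst n) = 1"
| "ncost (NGet a i j) = 1 + ncost i + ncost j"
| "ncost (NAdd e f) = 1 + ncost e + ncost f"
| "ncost (NSub e f) = 1 + ncost e + ncost f"

primrec rcost :: "rexp \<Rightarrow> nat" where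
  "rcost (OfNat e) = 1 + ncost e"
| "rcost (RGet a i j) = 1 + ncost i + ncost j"
| "rcost (RAdd e f) = 1 + rcost e + rcost f"
| "rcost (RSub e f) = 1 + rcost e + rcost f"
| "rcost (RMul e f) = 1 + rcost e + rcost f"
| "rcost (RDiv e f) = 1 + rcost e + rcost f"

primrec bcost :: "bexp \<Rightarrow> nat" where
  "bcost (NLess e f) = 1 + ncost e + ncost f"
| "bcost (RLess e f) = 1 + rcost e + rcost f"
| "bcost (BNot b) = 1 + bcost b"
| "bcost (BAnd b c) = 1 + bcost b + bcost c"

definition put :: "(name \<Rightarrow> nat \<Rightarrow> nat \<Rightarrow> 'a) \<Rightarrow> name \<Rightarrow> nat \<Rightarrow> nat \<Rightarrow> 'a \<Rightarrow> (name \<Rightarrow> nat \<Rightarrow> nat \<Rightarrow> 'a)" where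
  "put f a i j y = f(a := (f a)(i := (f a i)(j := y)))"

text \<open>\<open>exec P s t s'\<close>: started in \<open>s\<close>, the program \<open>P\<close> halts in \<open>s'\<close> after time \<open>t\<close>.\<close>

inductive exec :: "com \<Rightarrow> state \<Rightarrow> nat \<Rightarrow> state \<Rightarrow> bool" where
  Skip: "exec Skip s 1 s"
| NPut: "exec (NPut a i j e) s (1 + ncost i + ncost j + ncost e)
           (put (fst s) a (nval i s) (nval j s) (nval e s), snd s)"
| RPut: "exec (RPut a i j e) s (1 + ncost i + ncost j + rcost e)
           (fst s, put (snd s) a (nval i s) (nval j s) (rval e s))"
| Seq: "exec P s t s' \<Longrightarrow> exec Q s' t' s'' \<Longrightarrow> exec (Seq P Q) s (t + t') s''"
| CondTrue: "bval b s \<Longrightarrow> exec P s t s' \<Longrightarrow> exec (Cond b P Q) s (1 + bcost b + t) s'"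
| CondFalse: "\<not> bval b s \<Longrightarrow> exec Q s t s' \<Longrightarrow> exec (Cond b P Q) s (1 + bcost b + t) s'"
| WhileFalse: "\<not> bval b s \<Longrightarrow> exec (While b P) s (1 + bcost b) s"
| WhileTrue: "bval b s \<Longrightarrow> exec P s t s' \<Longrightarrow> exec (While b P) s' t' s'' \<Longrightarrow>
    exec (While b P) s (1 + bcost b + t + t') s''"

inductive_cases exec_elims:
  "exec Skip s t s'"
  "exec (NPut a i j e) s t s'"
  "exec (RPut a i j e) s t s'"
  "exec (Seq P Q) s t s'"
  "exec (Cond b P Q) s t s'"
  "exec (While b P) s t s'"

lemma exec_deterministic:
  "exec P s t s' \<Longrightarrow> exec P s u s'' \<Longrightarrow> u = t \<and> s'' = s'"
proof (induction arbitrary: u s'' rule: exec.induct)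
  case (Skip s)
  then show ?case by (auto elim: exec_elims(1))
next
  case (NPut a i j e s)
  then show ?case by (auto elim: exec_elims(2))
next
  case (RPut a i j e s)
  then show ?case by (auto elim: exec_elims(3))
next
  case (Seq P s t s' Q t' s2)
  from Seq.prems obtain t1 s1 t2 where
    1: "u = t1 + t2" "exec P s t1 s1" "exec Q s1 t2 s''"
    by (rule exec_elims(4)) blast
  with Seq.IH(1)[OF 1(2)] Seq.IH(2) show ?case by auto
next
  case (CondTrue b s P t s' Q)
  from CondTrue.prems CondTrue.hyps(1) obtain t1 where
    1: "u = 1 + bcost b + t1" "exec P s t1 s''"
    by (elim exec_elims(5)) auto
  with CondTrue.IH[OF 1(2)] show ?case by simp
next
  case (CondFalse b s Q t s' P)
  from CondFalse.prems CondFalse.hyps(1) obtain t1 where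
    1: "u = 1 + bcost b + t1" "exec Q s t1 s''"
    by (elim exec_elims(5)) auto
  with CondFalse.IH[OF 1(2)] show ?case by simp
next
  case (WhileFalse b s P)
  from WhileFalse.prems show ?case
    by (rule exec_elims(6)) (use WhileFalse.hyps in auto)
next
  case (WhileTrue b s P t s' t' s2)
  from WhileTrue.prems obtain t1 s1 t2 where
    1: "u = 1 + bcost b + t1 + t2" "exec P s t1 s1" "exec (While b P) s1 t2 s''"
    by (rule exec_elims(6)) (use WhileTrue.hyps(1) in auto)
  with WhileTrue.IH(1)[OF 1(2)] WhileTrue.IH(2) show ?case by auto
qed

text \<open>The instance is passed in the scalars \<open>d\<close>, \<open>m\<close>, \<open>k\<close>, the array \<open>v\<close> whose row \<open>i\<close> is
  \<open>v\<^sub>i\<close>, and the column \<open>x\<close>; all other memory is 0.  The answer is read off column 0 of \<open>s\<close>.\<close>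

definition rounding_input ::
  "nat \<Rightarrow> nat \<Rightarrow> nat \<Rightarrow> (nat \<Rightarrow> real vec) \<Rightarrow> real vec \<Rightarrow> state" where
  "rounding_input d m k v x =
    ((\<lambda>a i j. if i = 0 \<and> j = 0 then
                (if a = ''d'' then d else if a = ''m'' then m else if a = ''k'' then k else 0)
              else 0),
     (\<lambda>a i j. if a = ''v'' \<and> i < m \<and> j < d then v i $ j
              else if a = ''x'' \<and> i < m \<and> j = 0 then x $ i
              else 0))"

definition rounding_output :: "nat \<Rightarrow> state \<Rightarrow> nat list" where
  "rounding_output k s = map (\<lambda>j. fst s ''s'' j 0) [0..<k]"


section \<open>The matrix multiplication exponent\<close>

text \<open>Arithmetic straight-line programs over the reals: each gate appends its value to the list of
  inputs and earlier results.\<close>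

datatype gate = GConst real | GAdd nat nat | GSub nat nat | GMul nat nat | GDiv nat nat

primrec gate_val :: "gate \<Rightarrow> real list \<Rightarrow> real" where
  "gate_val (GConst c) ys = c"
| "gate_val (GAdd i j) ys = nth_default 0 ys i + nth_default 0 ys j"
| "gate_val (GSub i j) ys = nth_default 0 ys i - nth_default 0 ys j"
| "gate_val (GMul i j) ys = nth_default 0 ys i * nth_default 0 ys j"
| "gate_val (GDiv i j) ys = nth_default 0 ys i / nth_default 0 ys j"

primrec slp_run :: "gate list \<Rightarrow> real list \<Rightarrow> real list" where
  "slp_run [] ys = ys"
| "slp_run (g # gs) ys = slp_run gs (ys @ [gate_val g ys])"

text \<open>The position \<open>out i j\<close> holds the entry \<open>(i, j)\<close> of the product.\<close>

definition slp_multiplies :: "nat \<Rightarrow> gate list \<Rightarrow> (nat \<Rightarrow> nat \<Rightarrow> nat) \<Rightarrow> bool" where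
  "slp_multiplies n gs out \<longleftrightarrow>
     (\<forall>A\<in>carrier_mat n n. \<forall>B\<in>carrier_mat n n. \<forall>i<n. \<forall>j<n.
        nth_default 0 (slp_run gs (concat (mat_to_list A) @ concat (mat_to_list B))) (out i j)
          = (A * B) $$ (i, j))"

definition matmul_exponent :: real ("\<omega>") where
  "\<omega> = Inf {\<tau>. \<exists>C. \<forall>n\<ge>1. \<exists>gs out. slp_multiplies n gs out \<and> real (length gs) \<le> C * real n powr \<tau>}"

end

theory Submission
  imports Defs "Jordan_Normal_Form.Char_Poly"
begin

text \<open>
  The rounding is the method of conditional expectations for \<open>k\<close> independent samples, the index
  \<open>i\<close> having probability \<open>x(i) / k\<close>.  Put \<open>Y = k X\<^sup>-\<^sup>1\<close>, \<open>u\<^sub>i = Y v\<^sub>i\<close> and \<open>B = \<Sum>\<^sub>j v\<^bsub>s\<^sub>j\<^esub> u\<^bsub>s\<^sub>j\<^esub>\<^sup>T\<close>, so that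
  \<open>det B\<close> is \<open>k\<^sup>d / det X\<close> times the determinant to be bounded.  By the matrix determinant lemma and
  Jacobi's formula, averaging \<open>det (z I + B + v\<^sub>i u\<^sub>i\<^sup>T)\<close> over \<open>i\<close> applies \<open>1 + d/dz\<close> to
  \<open>det (z I + B)\<close>.  Hence the conditional expectation with \<open>r\<close> samples left is
  \<open>(1 + d/dz)\<^sup>r det (z I + B)\<close> at \<open>z = 0\<close>, and initially it is \<open>(1 + d/dz)\<^sup>k z\<^sup>d\<close> at \<open>0\<close>, that is
  \<open>k! / (k - d)!\<close>.

  Adding \<open>v\<^sub>i u\<^sub>i\<^sup>T\<close> changes the conditional expectation by \<open>u\<^sub>i\<^sup>T G v\<^sub>i\<close>, where \<open>G\<close> does not depend on
  \<open>i\<close> and is a combination of the coefficients of \<open>adj (z I + B)\<close>.  These are computed by the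
  Faddeev-LeVerrier recurrence with \<open>d\<close> naive matrix products.  Since \<open>det X = 0\<close> unless \<open>d \<le> m\<close>, a
  step costs \<open>O(d\<^sup>4 + m d\<^sup>2) = O(m d\<^sup>3)\<close>, which suffices because \<open>\<omega> \<ge> 2\<close>.
\<close>

section \<open>Determinants and adjugates of \<open>z I + B\<close>\<close>

text \<open>The bordered matrix \<open>E\<close> with blocks M, -v, u, 1 is evaluated twice:
  \<open>L * E\<close> clears the border column and leaves det (M + v u^T), while
  \<open>E * R\<close> clears it through the adjugate and leaves det M times the corner entry
  \<open>F\<close>. Using the adjugate instead of an inverse makes the identity available over
  polynomials.\<close>

lemma det_add_rank_one:
  fixes M :: "'a :: idom mat"
  assumes M: "M \<in> carrier_mat n n" and nz: "det M \<noteq> 0"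
  shows "det (M + mat n n (\<lambda>(i, j). v i * u j)) =
    det M + (\<Sum>i<n. \<Sum>j<n. u i * adj_mat M $$ (i, j) * v j)"
proof -
  define V where "V = mat n 1 (\<lambda>(i, j). - v i)"
  define V' where "V' = mat n 1 (\<lambda>(i, j). v i)"
  define U where "U = mat 1 n (\<lambda>(i, j). u j)"
  define D where "D = mat 1 1 (\<lambda>_. det M)"
  define A where "A = adj_mat M"
  have A: "A \<in> carrier_mat n n" "M * A = det M \<cdot>\<^sub>m 1\<^sub>m n"
    using adj_mat[OF M] by (auto simp: A_def)
  have c: "V \<in> carrier_mat n 1" "V' \<in> carrier_mat n 1" "U \<in> carrier_mat 1 n" "D \<in> carrier_mat 1 1"
    by (auto simp: V_def V'_def U_def D_def)
  define E where "E = four_block_mat M V U (1\<^sub>m 1)"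
  define L where "L = four_block_mat (1\<^sub>m n) V' (0\<^sub>m 1 n) (1\<^sub>m 1)"
  define R where "R = four_block_mat (1\<^sub>m n) (A * V') (0\<^sub>m 1 n) D"
  have cE: "E \<in> carrier_mat (n + 1) (n + 1)" "L \<in> carrier_mat (n + 1) (n + 1)"
    "R \<in> carrier_mat (n + 1) (n + 1)"
    using M A c unfolding E_def L_def R_def by (auto intro!: four_block_carrier_mat)
  have "L * E = four_block_mat (1\<^sub>m n * M + V' * U) (1\<^sub>m n * V + V' * 1\<^sub>m 1)
      (0\<^sub>m 1 n * M + 1\<^sub>m 1 * U) (0\<^sub>m 1 n * V + 1\<^sub>m 1 * 1\<^sub>m 1)"
    unfolding L_def E_def by (rule mult_four_block_mat) (use M c in auto)
  moreover have "1\<^sub>m n * V + V' * 1\<^sub>m 1 = 0\<^sub>m n 1"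
    using c by (intro eq_matI) (auto simp: V_def V'_def)
  moreover have "V' * U = mat n n (\<lambda>(i, j). v i * u j)"
    by (intro eq_matI) (auto simp: V'_def U_def scalar_prod_def)
  moreover have "0\<^sub>m 1 n * M + 1\<^sub>m 1 * U = U" using M c by simp
  moreover have "0\<^sub>m 1 n * V + 1\<^sub>m 1 * 1\<^sub>m 1 = (1\<^sub>m 1 :: 'a mat)" using c by simp
  ultimately have LE: "L * E = four_block_mat (M + mat n n (\<lambda>(i, j). v i * u j)) (0\<^sub>m n 1) U (1\<^sub>m 1)"
    using M by simp
  have "E * R = four_block_mat (M * 1\<^sub>m n + V * 0\<^sub>m 1 n) (M * (A * V') + V * D)
      (U * 1\<^sub>m n + 1\<^sub>m 1 * 0\<^sub>m 1 n) (U * (A * V') + 1\<^sub>m 1 * D)"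
    unfolding R_def E_def by (rule mult_four_block_mat) (use M A c in auto)
  moreover have "M * (A * V') + V * D = 0\<^sub>m n 1"
  proof -
    have "M * (A * V') = det M \<cdot>\<^sub>m V'"
      using assoc_mult_mat[OF M A(1) c(2)] A(2) c mult_smult_assoc_mat[OF one_carrier_mat c(2), of "det M"]
      by simp
    moreover have "V * D = - (det M \<cdot>\<^sub>m V')"
      by (intro eq_matI) (auto simp: V_def V'_def D_def scalar_prod_def)
    ultimately show ?thesis using c by (intro eq_matI) auto
  qed
  moreover have "M * 1\<^sub>m n + V * 0\<^sub>m 1 n = M" "U * 1\<^sub>m n + 1\<^sub>m 1 * 0\<^sub>m 1 n = U"
    using M c by auto
  moreover define F where "F = U * (A * V') + 1\<^sub>m 1 * D"
  ultimately have ER: "E * R = four_block_mat M (0\<^sub>m n 1) U F" by simp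
  have cF: "F \<in> carrier_mat 1 1" using M A c unfolding F_def by auto
  have "det E = det (L * E)"
    using det_mult[OF cE(2,1)] det_four_block_mat_lower_left_zero[OF one_carrier_mat c(2) refl one_carrier_mat]
    by (simp add: L_def)
  also have "\<dots> = det (M + mat n n (\<lambda>(i, j). v i * u j))"
    unfolding LE by (subst det_four_block_mat_upper_right_zero[where m = 1]) (use M c in auto)
  finally have 1: "det E = det (M + mat n n (\<lambda>(i, j). v i * u j))" .
  \<comment> \<open>\<open>R\<close> also has determinant \<open>det M\<close>, so this factor
    stands on both sides and \<open>nz\<close> cancels it.\<close>
  have "det E * det M = det (E * R)"
    using det_mult[OF cE(1,3)] A c
      det_four_block_mat_lower_left_zero[of "1\<^sub>m n" n "A * V'" 1 "0\<^sub>m 1 n" D]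
    by (simp add: R_def det_single D_def)
  also have "\<dots> = det M * F $$ (0, 0)"
    unfolding ER by (subst det_four_block_mat_upper_right_zero[where m = 1]) (use M c cF in \<open>auto simp: det_single\<close>)
  finally have 2: "det E = F $$ (0, 0)" using nz by (simp add: mult.commute)
  have "F $$ (0, 0) = (\<Sum>i<n. u i * (\<Sum>j<n. A $$ (i, j) * v j)) + det M"
    using A c unfolding F_def
    by (auto simp: U_def V'_def D_def scalar_prod_def atLeast0LessThan intro!: sum.cong)
  then show ?thesis using 1 2 by (simp add: A_def sum_distrib_left mult.assoc add.commute)
qed

text \<open>\<open>pencil B\<close> is \<open>z I + B\<close> as a matrix of polynomials in \<open>z\<close>.\<close>

definition pencil :: "real mat \<Rightarrow> real poly mat" where
  "pencil B = char_poly_matrix (- B)"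

text \<open>This is the characteristic polynomial of \<open>- B\<close>, so degree, leading
  coefficient and derivative come from known facts.\<close>

definition shifted_det :: "real mat \<Rightarrow> real poly" where
  "shifted_det B = det (pencil B)"

text \<open>These are the matrices N_i in adj (z I + B) = sum_i z^i N_i, which the Faddeev-LeVerrier
  recurrence produces.\<close>

definition adj_coeff :: "real mat \<Rightarrow> nat \<Rightarrow> real mat" where
  "adj_coeff B i = map_mat (\<lambda>p. coeff p i) (adj_mat (pencil B))"

section \<open>Dimensions, values and degrees for the pencil and its adjugate\<close>

lemma dim_pencil [simp]: "dim_row (pencil B) = dim_row B" "dim_col (pencil B) = dim_col B"
  by (simp_all add: pencil_def char_poly_matrix_def)

lemma dim_adj_mat [simp]: "dim_row (adj_mat M) = dim_row M" "dim_col (adj_mat M) = dim_col M"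
  by (simp_all add: adj_mat_def)

lemma dim_adj_coeff [simp]: "dim_row (adj_coeff B i) = dim_row B" "dim_col (adj_coeff B i) = dim_col B"
  by (simp_all add: adj_coeff_def)

lemma pencil_carrier [simp]: "B \<in> carrier_mat n n \<Longrightarrow> pencil B \<in> carrier_mat n n"
  by (simp add: pencil_def)

lemma pencil_index:
  "B \<in> carrier_mat n n \<Longrightarrow> i < n \<Longrightarrow> j < n \<Longrightarrow>
    pencil B $$ (i, j) = [:B $$ (i, j), if i = j then 1 else 0:]"
  by (auto simp: pencil_def char_poly_matrix_def)

lemma shifted_det_monic:
  "B \<in> carrier_mat n n \<Longrightarrow> degree (shifted_det B) = n \<and> coeff (shifted_det B) n = 1"
  using degree_monic_char_poly[of "- B" n] by (simp add: shifted_det_def pencil_def char_poly_def)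

lemma shifted_det_nonzero: "B \<in> carrier_mat n n \<Longrightarrow> shifted_det B \<noteq> 0"
  using shifted_det_monic[of B n] by auto

lemma poly_shifted_det:
  "B \<in> carrier_mat n n \<Longrightarrow> poly (shifted_det B) z = det (z \<cdot>\<^sub>m 1\<^sub>m n + B)"
  unfolding shifted_det_def by (rule poly_det_cong[of _ n]) (auto simp: pencil_index)

lemma poly_shifted_det_0: "B \<in> carrier_mat n n \<Longrightarrow> poly (shifted_det B) 0 = det B"
  unfolding shifted_det_def by (rule poly_det_cong[of _ n]) (auto simp: pencil_index)

lemma adj_coeff_carrier [simp]: "B \<in> carrier_mat n n \<Longrightarrow> adj_coeff B i \<in> carrier_mat n n"
  using adj_mat(1)[OF pencil_carrier] by (auto simp: adj_coeff_def)

text \<open>A cofactor is a minor of size n - 1 with entries of degree at most 1, so no entry of the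
  adjugate reaches degree n.\<close>

lemma adj_coeff_eq_0:
  assumes B: "B \<in> carrier_mat n n" and i: "i \<ge> n"
  shows "adj_coeff B i = 0\<^sub>m n n"
proof (intro eq_matI)
  fix a b assume ab: "a < dim_row (0\<^sub>m n n :: real mat)" "b < dim_col (0\<^sub>m n n :: real mat)"
  have P: "pencil B \<in> carrier_mat n n" using B by simp
  have "degree (det (mat_delete (pencil B) b a)) \<le> 1 * (n - 1)"
  proof (rule degree_det_le)
    show "mat_delete (pencil B) b a \<in> carrier_mat (n - 1) (n - 1)"
      using P mat_delete_carrier by blast
  next
    fix i j assume "i < n - 1" "j < n - 1"
    then show "degree (mat_delete (pencil B) b a $$ (i, j)) \<le> 1"
      using P ab B by (auto simp: mat_delete_def pencil_index)
  qed
  then have "degree (cofactor (pencil B) b a) \<le> n - 1"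
    unfolding cofactor_def minus_one_power_iff by simp
  then have "coeff (cofactor (pencil B) b a) i = 0" using i ab by (intro coeff_eq_0) auto
  then show "adj_coeff B i $$ (a, b) = 0\<^sub>m n n $$ (a, b)"
    using ab B by (auto simp: adj_coeff_def adj_mat_def)
qed (use B in auto)

section \<open>Faddeev-LeVerrier relations and Jacobi's formula\<close>

lemma adj_mat_pencil_carrier: "B \<in> carrier_mat n n \<Longrightarrow> adj_mat (pencil B) \<in> carrier_mat n n"
  by (rule adj_mat) simp

lemma adj_coeff_index:
  "B \<in> carrier_mat n n \<Longrightarrow> a < n \<Longrightarrow> b < n \<Longrightarrow> adj_coeff B i $$ (a, b) = coeff (adj_mat (pencil B) $$ (a, b)) i"
  using adj_mat_pencil_carrier[of B n] by (auto simp: adj_coeff_def)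

text \<open>This is an entry of (z I + B) adj (z I + B) = det (z I + B) I, with the contribution of
  z I split off as \<open>pCons 0\<close> so that coefficients can be compared.\<close>

lemma pencil_mult_adj_index:
  assumes B: "B \<in> carrier_mat n n" and ab: "a < n" "b < n"
  shows "(if a = b then shifted_det B else 0) =
    pCons 0 (adj_mat (pencil B) $$ (a, b)) + (\<Sum>c<n. smult (B $$ (a, c)) (adj_mat (pencil B) $$ (c, b)))"
proof -
  define A where "A = adj_mat (pencil B)"
  have A: "A \<in> carrier_mat n n" "pencil B * A = shifted_det B \<cdot>\<^sub>m 1\<^sub>m n"
    using adj_mat[of "pencil B" n] B by (auto simp: A_def shifted_det_def)
  have "(if a = b then shifted_det B else 0) = (pencil B * A) $$ (a, b)"
    unfolding A(2) using ab by auto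
  also have "\<dots> = (\<Sum>c<n. pencil B $$ (a, c) * A $$ (c, b))"
    using ab A(1) B by (auto simp: scalar_prod_def atLeast0LessThan)
  also have "\<dots> = (\<Sum>c<n. smult (B $$ (a, c)) (A $$ (c, b)) + (if a = c then pCons 0 (A $$ (a, b)) else 0))"
    using ab by (intro sum.cong refl) (auto simp: pencil_index[OF B])
  finally show ?thesis using ab by (simp add: sum.distrib A_def)
qed

text \<open>Compare the coefficients of z^(i+1) in \<open>pencil_mult_adj_index\<close>. The
  recurrence runs downwards in i.\<close>

lemma adj_coeff_recurrence:
  assumes B: "B \<in> carrier_mat n n"
  shows "adj_coeff B i = coeff (shifted_det B) (Suc i) \<cdot>\<^sub>m 1\<^sub>m n - B * adj_coeff B (Suc i)"
proof (rule eq_matI)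
  fix a b
  assume "a < dim_row (coeff (shifted_det B) (Suc i) \<cdot>\<^sub>m 1\<^sub>m n - B * adj_coeff B (Suc i))"
    and "b < dim_col (coeff (shifted_det B) (Suc i) \<cdot>\<^sub>m 1\<^sub>m n - B * adj_coeff B (Suc i))"
  then have ab: "a < n" "b < n" using B adj_coeff_carrier[OF B, of "Suc i"] by auto
  have "(B * adj_coeff B (Suc i)) $$ (a, b) =
      (\<Sum>c<n. B $$ (a, c) * coeff (adj_mat (pencil B) $$ (c, b)) (Suc i))"
    using ab B adj_coeff_carrier[OF B, of "Suc i"]
    by (auto simp: scalar_prod_def atLeast0LessThan adj_coeff_index[OF B])
  then show "adj_coeff B i $$ (a, b) =
      (coeff (shifted_det B) (Suc i) \<cdot>\<^sub>m 1\<^sub>m n - B * adj_coeff B (Suc i)) $$ (a, b)"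
    using ab B adj_coeff_carrier[OF B, of "Suc i"] adj_coeff_carrier[OF B, of i]
      arg_cong[OF pencil_mult_adj_index[OF B ab], of "\<lambda>p. coeff p (Suc i)"]
    by (auto simp: coeff_sum adj_coeff_index[OF B])
qed (use B adj_coeff_carrier[OF B] in auto)

text \<open>Evaluation at z = 0 commutes with taking minors. This lets the recurrence compute the
  adjugate of X as well.\<close>

lemma adj_coeff_0:
  assumes B: "B \<in> carrier_mat n n"
  shows "adj_coeff B 0 = adj_mat B"
proof (rule eq_matI)
  fix a b assume "a < dim_row (adj_mat B)" "b < dim_col (adj_mat B)"
  then have ab: "a < n" "b < n" using adj_mat(1)[OF B] by auto
  have P: "pencil B \<in> carrier_mat n n" using B by simp
  have "poly (det (mat_delete (pencil B) b a)) 0 = det (mat_delete B b a)"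
    by (rule poly_det_cong[of _ "n - 1"]) (use ab B P in \<open>auto simp: mat_delete_def pencil_index\<close>)
  then have "poly (cofactor (pencil B) b a) 0 = cofactor B b a"
    by (simp add: cofactor_def poly_power)
  then show "adj_coeff B 0 $$ (a, b) = adj_mat B $$ (a, b)"
    using ab B P by (simp add: adj_coeff_index[OF B] adj_mat_def poly_0_coeff_0)
qed (use B adj_coeff_carrier[OF B, of 0] adj_mat(1)[OF B] in auto)

text \<open>Jacobi's formula: the derivative of a characteristic polynomial is the sum of those of
  the principal submatrices, and these are the diagonal cofactors of the pencil.\<close>

lemma pderiv_shifted_det:
  assumes B: "B \<in> carrier_mat n n"
  shows "pderiv (shifted_det B) = (\<Sum>i<n. adj_mat (pencil B) $$ (i, i))"
proof -
  have "pderiv (shifted_det B) = (\<Sum>i<n. char_poly (mat_delete (- B) i i))"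
    using pderiv_char_poly[of "- B" n] B by (simp add: shifted_det_def pencil_def char_poly_def)
  also have "\<dots> = (\<Sum>i<n. adj_mat (pencil B) $$ (i, i))"
  proof (rule sum.cong[OF refl])
    fix i assume "i \<in> {..<n}"
    then have i: "i < n" by simp
    have "char_poly_matrix (mat_delete (- B) i i) = mat_delete (pencil B) i i"
      using i B unfolding pencil_def
      by (intro eq_matI) (auto simp: char_poly_matrix_def mat_delete_def)
    then show "char_poly (mat_delete (- B) i i) = adj_mat (pencil B) $$ (i, i)"
      using i B by (auto simp: char_poly_def adj_mat_def cofactor_def)
  qed
  finally show ?thesis .
qed

lemma trace_adj_coeff:
  assumes B: "B \<in> carrier_mat n n"
  shows "(\<Sum>a<n. adj_coeff B i $$ (a, a)) = real (Suc i) * coeff (shifted_det B) (Suc i)"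
  using arg_cong[OF pderiv_shifted_det[OF B], of "\<lambda>p. coeff p i"]
  by (simp add: coeff_sum coeff_pderiv adj_coeff_index[OF B])

lemma adj_coeff_top:
  assumes B: "B \<in> carrier_mat n n" and n: "n > 0"
  shows "adj_coeff B (n - 1) = 1\<^sub>m n"
proof -
  have "adj_coeff B (n - 1) = 1 \<cdot>\<^sub>m 1\<^sub>m n - B * 0\<^sub>m n n"
    using adj_coeff_recurrence[OF B, of "n - 1"] adj_coeff_eq_0[OF B, of n] shifted_det_monic[OF B] n
    by simp
  also have "\<dots> = 1\<^sub>m n" using B by (intro eq_matI) auto
  finally show ?thesis .
qed

text \<open>Let c be the coefficient. By \<open>trace_adj_coeff\<close>, the trace of
  \<open>adj_coeff_recurrence\<close> reads (i+1) c = n c - tr (B N_(i+1)); solve for c. So c is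
  known before N_i is formed.\<close>

lemma shifted_det_coeff_trace:
  assumes B: "B \<in> carrier_mat n n" and i: "Suc i < n"
  shows "coeff (shifted_det B) (Suc i) =
    (\<Sum>a<n. (B * adj_coeff B (Suc i)) $$ (a, a)) / real (n - Suc i)"
proof -
  let ?c = "coeff (shifted_det B) (Suc i)"
  have "real (Suc i) * ?c = (\<Sum>a<n. (?c \<cdot>\<^sub>m 1\<^sub>m n - B * adj_coeff B (Suc i)) $$ (a, a))"
    using trace_adj_coeff[OF B, of i] adj_coeff_recurrence[OF B, of i] by simp
  also have "\<dots> = (\<Sum>a<n. ?c - (B * adj_coeff B (Suc i)) $$ (a, a))"
    using B adj_coeff_carrier[OF B, of "Suc i"] by (intro sum.cong refl) (subst index_minus_mat, auto)
  also have "\<dots> = real n * ?c - (\<Sum>a<n. (B * adj_coeff B (Suc i)) $$ (a, a))"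
    by (simp add: sum_subtractf)
  finally show ?thesis using i by (simp add: field_simps of_nat_diff)
qed

text \<open>The matrix determinant lemma applies over polynomials even for singular
  \<open>B\<close>, since the determinant of the pencil is monic and hence nonzero.\<close>

lemma shifted_det_add_rank_one:
  assumes B: "B \<in> carrier_mat n n"
  shows "shifted_det (B + mat n n (\<lambda>(i, j). v i * u j)) =
    shifted_det B + (\<Sum>i<n. \<Sum>j<n. smult (u i * v j) (adj_mat (pencil B) $$ (i, j)))"
proof -
  have "pencil (B + mat n n (\<lambda>(i, j). v i * u j)) =
      pencil B + mat n n (\<lambda>(i, j). [:v i:] * [:u j:])"
    using B pencil_carrier[OF B] pencil_carrier[of "B + mat n n (\<lambda>(i, j). v i * u j)" n]
    by (intro eq_matI)
      (auto simp: pencil_index[where n = n])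
  then show ?thesis
    using det_add_rank_one[of "pencil B" n "\<lambda>i. [:v i:]" "\<lambda>i. [:u i:]"] B shifted_det_nonzero[OF B]
    unfolding shifted_det_def by (simp add: ac_simps smult_smult)
qed

section \<open>Conditional expectations and the greedy choice\<close>

text \<open>The falling factorial r (r-1) ... (r-i+1). The factors are real differences, but for i >
  r one of them is 0 and the product vanishes.\<close>

definition falling :: "nat \<Rightarrow> nat \<Rightarrow> real" where
  "falling r i = (\<Prod>j<i. real r - real j)"

lemma falling_0 [simp]: "falling r 0 = 1"
  by (simp add: falling_def)

lemma falling_Suc: "falling r (Suc i) = falling r i * (real r - real i)"
  by (simp add: falling_def)

lemma falling_0_left: "falling 0 i = (if i = 0 then 1 else 0)"
  by (auto simp: falling_def intro!: prod_zero)

text \<open>Pascal's rule multiplied by (i+1)!. It accounts for one application of 1 + d/dz.\<close>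

lemma falling_Suc_Suc: "falling (Suc r) (Suc i) = falling r (Suc i) + real (Suc i) * falling r i"
proof -
  have "falling (Suc r) (Suc i) = (real r + 1) * falling r i"
    by (simp add: falling_def prod.lessThan_Suc_shift del: prod.lessThan_Suc)
  then show ?thesis by (simp add: falling_Suc algebra_simps)
qed

lemma falling_eq_fact: "i \<le> r \<Longrightarrow> falling r i = fact r / fact (r - i)"
proof (induction i)
  case (Suc i)
  then have "fact (r - i) = real (r - i) * (fact (r - Suc i) :: real)"
    by (metis Suc_diff_Suc Suc_le_lessD fact_Suc of_nat_mult of_nat_fact)
  with Suc show ?case by (simp add: falling_Suc of_nat_diff field_simps)
qed simp

text \<open>\<open>derandomized r q\<close> is \<open>(1 + d/dz)\<^sup>r q\<close> at \<open>z = 0\<close>; for \<open>q = det (z I + B)\<close> it is the expectation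
  of the determinant after adding \<open>r\<close> further random rank-one matrices to \<open>B\<close>.\<close>

fun derandomized :: "nat \<Rightarrow> real poly \<Rightarrow> real" where
  "derandomized 0 q = poly q 0"
| "derandomized (Suc r) q = derandomized r (q + pderiv q)"

section \<open>Linearity and closed form of (1 + d/dz)^r at 0\<close>

lemma derandomized_add: "derandomized r (p + q) = derandomized r p + derandomized r q"
proof (induction r arbitrary: p q)
  case (Suc r)
  have "p + q + pderiv (p + q) = (p + pderiv p) + (q + pderiv q)" by (simp add: pderiv_add)
  with Suc show ?case by (metis derandomized.simps(2))
qed simp

lemma derandomized_smult: "derandomized r (smult c p) = c * derandomized r p"
proof (induction r arbitrary: p)
  case (Suc r)
  have "smult c p + pderiv (smult c p) = smult c (p + pderiv p)" by (simp add: pderiv_smult smult_add_right)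
  with Suc show ?case by (metis derandomized.simps(2))
qed simp

lemma derandomized_0: "derandomized r 0 = 0"
  using derandomized_smult[of r 0 0] by simp

lemma derandomized_sum: "derandomized r (\<Sum>i\<in>A. f i) = (\<Sum>i\<in>A. derandomized r (f i))"
  by (induction A rule: infinite_finite_induct) (auto simp: derandomized_0 derandomized_add)

text \<open>The i-th term of the binomial expansion is binom(r, i) times the i-th derivative at 0,
  which is i! times the i-th coefficient; binom(r, i) i! is the falling factorial.\<close>

lemma derandomized_eq_sum:
  "degree q \<le> n \<Longrightarrow> derandomized r q = (\<Sum>i\<le>n. falling r i * coeff q i)"
proof (induction r arbitrary: q)
  case 0
  have "(\<Sum>i\<le>n. falling 0 i * coeff q i) = (\<Sum>i\<le>n. if i = 0 then coeff q i else 0)"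
    by (intro sum.cong) (auto simp: falling_0_left)
  then show ?case by (simp add: poly_0_coeff_0)
next
  case (Suc r)
  define g where "g i = real i * falling r (i - 1) * coeff q i" for i
  have "degree (q + pderiv q) \<le> n"
    using Suc.prems degree_add_le[of q n "pderiv q"] degree_pderiv_le[of q] by simp
  then have "derandomized (Suc r) q = (\<Sum>i\<le>n. falling r i * coeff (q + pderiv q) i)"
    using Suc.IH by simp
  also have "\<dots> = (\<Sum>i\<le>n. falling r i * coeff q i) + (\<Sum>i\<le>n. g (Suc i))"
    unfolding sum.distrib[symmetric] by (intro sum.cong) (auto simp: coeff_pderiv algebra_simps g_def)
  \<comment> \<open>The index shift loses nothing: \<open>g 0\<close> has a factor 0, and
    \<open>g (Suc n)\<close> contains a coefficient beyond the degree.\<close>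
  also have "(\<Sum>i\<le>n. g (Suc i)) = (\<Sum>i\<le>n. g i)"
  proof -
    have "g (Suc n) = 0" using Suc.prems by (simp add: g_def coeff_eq_0)
    moreover have "g 0 = 0" by (simp add: g_def)
    ultimately show ?thesis using sum.atMost_Suc_shift[of g n] by simp
  qed
  also have "(\<Sum>i\<le>n. falling r i * coeff q i) + (\<Sum>i\<le>n. g i) = (\<Sum>i\<le>n. falling (Suc r) i * coeff q i)"
    unfolding sum.distrib[symmetric]
  proof (rule sum.cong[OF refl])
    fix i
    show "falling r i * coeff q i + g i = falling (Suc r) i * coeff q i"
      by (cases i) (auto simp: g_def falling_Suc_Suc algebra_simps)
  qed
  finally show ?case .
qed

text \<open>This is (1 + d/dz)^r applied entrywise to adj (z I + B), at z = 0: the matrix G of a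
  greedy step.\<close>

definition gain_mat :: "nat \<Rightarrow> nat \<Rightarrow> real mat \<Rightarrow> real mat" where
  "gain_mat d r B = mat d d (\<lambda>(a, b). \<Sum>i<d. falling r i * adj_coeff B i $$ (a, b))"

lemma derandomized_adj_pencil:
  assumes B: "B \<in> carrier_mat d d" and ab: "a < d" "b < d"
  shows "derandomized r (adj_mat (pencil B) $$ (a, b)) = gain_mat d r B $$ (a, b)"
proof -
  have z: "coeff (adj_mat (pencil B) $$ (a, b)) i = 0" if "i \<ge> d" for i
    using adj_coeff_eq_0[OF B that] adj_coeff_index[OF B ab, of i] ab by simp
  then have "degree (adj_mat (pencil B) $$ (a, b)) \<le> d" by (intro degree_le) auto
  then show ?thesis
    using z ab by (simp add: derandomized_eq_sum gain_mat_def adj_coeff_index[OF B] flip: lessThan_Suc_atMost)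
qed

lemma gain_mat_0:
  assumes "B \<in> carrier_mat d d" "a < d" "b < d"
  shows "gain_mat d 0 B $$ (a, b) = adj_mat B $$ (a, b)"
proof -
  have "gain_mat d 0 B $$ (a, b) = (\<Sum>i<d. if i = 0 then adj_coeff B i $$ (a, b) else 0)"
    using assms by (simp add: gain_mat_def falling_0_left if_distrib[of "\<lambda>x. x * _"] cong: if_cong)
  also have "\<dots> = adj_coeff B 0 $$ (a, b)" using assms by (simp add: sum.delta)
  finally show ?thesis using adj_coeff_0[OF assms(1)] by simp
qed

text \<open>By \<open>derandomized_add_rank_one\<close> this is the change of the conditional
  expectation when v u^T is added and \<open>r\<close> samples remain.\<close>

definition gain :: "nat \<Rightarrow> nat \<Rightarrow> real mat \<Rightarrow> (nat \<Rightarrow> real) \<Rightarrow> (nat \<Rightarrow> real) \<Rightarrow> real" where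
  "gain d r B u v = (\<Sum>a<d. \<Sum>b<d. u a * gain_mat d r B $$ (a, b) * v b)"

text \<open>Only the first \<open>d\<close> coordinates enter, which allows rows of the program's
  arrays to replace the given vectors.\<close>

lemma gain_cong:
  "(\<And>a. a < d \<Longrightarrow> u a = u' a) \<Longrightarrow> (\<And>a. a < d \<Longrightarrow> v a = v' a) \<Longrightarrow> gain d r B u v = gain d r B u' v'"
  by (simp add: gain_def)

lemma derandomized_add_rank_one:
  assumes B: "B \<in> carrier_mat d d"
  shows "derandomized r (shifted_det (B + mat d d (\<lambda>(i, j). v i * u j))) =
    derandomized r (shifted_det B) + gain d r B u v"
  unfolding shifted_det_add_rank_one[OF B] gain_def
  by (auto simp: derandomized_add derandomized_sum derandomized_smult derandomized_adj_pencil[OF B]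
      intro!: sum.cong)

text \<open>Isotropy turns the average of the forms u_i^T G v_i into the trace of G, and Jacobi's
  formula identifies this trace with the operator applied to the derivative.\<close>

lemma sum_weighted_gain:
  assumes B: "B \<in> carrier_mat d d"
    and iso: "\<And>a b. a < d \<Longrightarrow> b < d \<Longrightarrow>
      (\<Sum>i<m. p i * (v i a * u i b)) = (if a = b then 1 else 0)"
  shows "(\<Sum>i<m. p i * gain d r B (u i) (v i)) = derandomized r (pderiv (shifted_det B))"
proof -
  have "(\<Sum>i<m. p i * gain d r B (u i) (v i)) =
      (\<Sum>i<m. \<Sum>a<d. \<Sum>b<d. gain_mat d r B $$ (a, b) * (p i * (v i b * u i a)))"
    unfolding gain_def sum_distrib_left by (simp add: mult_ac)
  also have "\<dots> = (\<Sum>a<d. \<Sum>i<m. \<Sum>b<d. gain_mat d r B $$ (a, b) * (p i * (v i b * u i a)))"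
    by (rule sum.swap)
  also have "\<dots> = (\<Sum>a<d. \<Sum>b<d. \<Sum>i<m. gain_mat d r B $$ (a, b) * (p i * (v i b * u i a)))"
    by (rule sum.cong[OF refl], rule sum.swap)
  also have "\<dots> = (\<Sum>a<d. \<Sum>b<d. if b = a then gain_mat d r B $$ (a, a) else 0)"
    unfolding sum_distrib_left[symmetric] by (intro sum.cong refl) (auto simp: iso)
  also have "\<dots> = derandomized r (pderiv (shifted_det B))"
    unfolding pderiv_shifted_det[OF B] derandomized_sum
    by (intro sum.cong) (auto simp: derandomized_adj_pencil[OF B])
  finally show ?thesis .
qed

text \<open>The best gain is at least the average gain, so the conditional expectation never
  decreases along the greedy sequence. It starts at \<open>falling k d\<close> and ends as the
  determinant itself.\<close>

lemma greedy_det_ge: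
  assumes p: "\<And>i. i < m \<Longrightarrow> p i \<ge> 0" "(\<Sum>i<m. p i) = 1"
    and iso: "\<And>a b. a < d \<Longrightarrow> b < d \<Longrightarrow>
      (\<Sum>i<m. p i * (v i a * u i b)) = (if a = b then 1 else 0)"
    and Bdef: "\<And>t. B t = mat d d (\<lambda>(a, b). \<Sum>l<t. v (s l) a * u (s l) b)"
    and greedy: "\<And>t i. t < k \<Longrightarrow> i < m \<Longrightarrow>
      gain d (k - 1 - t) (B t) (u i) (v i) \<le> gain d (k - 1 - t) (B t) (u (s t)) (v (s t))"
  shows "det (B k) \<ge> falling k d"
proof -
  have B: "B t \<in> carrier_mat d d" for t by (simp add: Bdef)
  \<comment> \<open>By linearity the left side is the value at q plus the value at its derivative,
    and the latter is the average gain.\<close>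
  have step: "derandomized (Suc r) (shifted_det (B t)) \<le> derandomized r (shifted_det (B (Suc t)))"
    if "t < k" "r = k - 1 - t" for r t
  proof -
    have "derandomized r (pderiv (shifted_det (B t))) = (\<Sum>i<m. p i * gain d r (B t) (u i) (v i))"
      by (rule sum_weighted_gain[OF B iso, symmetric])
    also have "\<dots> \<le> (\<Sum>i<m. p i * gain d r (B t) (u (s t)) (v (s t)))"
      using p greedy that by (intro sum_mono mult_left_mono) auto
    also have "\<dots> = gain d r (B t) (u (s t)) (v (s t))"
      using p(2) by (simp add: sum_distrib_right[symmetric])
    finally have *: "derandomized r (pderiv (shifted_det (B t))) \<le> gain d r (B t) (u (s t)) (v (s t))" .
    have "B (Suc t) = B t + mat d d (\<lambda>(i, j). v (s t) i * u (s t) j)"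
      by (intro eq_matI) (auto simp: Bdef)
    then have "derandomized r (shifted_det (B (Suc t))) =
        derandomized r (shifted_det (B t)) + gain d r (B t) (u (s t)) (v (s t))"
      using derandomized_add_rank_one[OF B] by simp
    then show ?thesis using * by (simp add: derandomized_add)
  qed
  have "t \<le> k \<Longrightarrow> derandomized k (shifted_det (B 0)) \<le> derandomized (k - t) (shifted_det (B t))" for t
  proof (induction t)
    case (Suc t)
    then have "k - t = Suc (k - 1 - t)" by simp
    with Suc step[of t "k - 1 - t"] show ?case by simp
  qed simp
  from this[of k] have "derandomized k (shifted_det (B 0)) \<le> poly (shifted_det (B k)) 0" by simp
  moreover have "poly (shifted_det (B k)) 0 = det (B k)"
    by (rule poly_shifted_det_0[OF B])
  moreover have "shifted_det (B 0) = monom 1 d"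
  proof (rule poly_eq_poly_eq_iff[THEN iffD1], rule ext)
    fix z
    have "z \<cdot>\<^sub>m 1\<^sub>m d + B 0 = z \<cdot>\<^sub>m 1\<^sub>m d" by (intro eq_matI) (auto simp: Bdef)
    then show "poly (shifted_det (B 0)) z = poly (monom 1 d) z"
      by (simp add: poly_shifted_det[OF B] poly_monom)
  qed
  moreover have "derandomized k (monom 1 d) = falling k d"
    by (subst derandomized_eq_sum[of _ d]) (auto simp: degree_monom_le if_distrib cong: if_cong)
  ultimately show ?thesis by simp
qed

section \<open>Gram matrices and the relaxation\<close>

lemma weighted_gram_carrier [simp]: "weighted_gram d m v x \<in> carrier_mat d d"
  by (simp add: weighted_gram_def)

lemma multiset_gram_carrier [simp]: "multiset_gram d v S \<in> carrier_mat d d"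
  by (simp add: multiset_gram_def)

lemma weighted_gram_quadratic_form:
  fixes w :: "real vec"
  assumes w: "w \<in> carrier_vec d"
  shows "w \<bullet> (weighted_gram d m v x *\<^sub>v w) = (\<Sum>i<m. x $ i * (\<Sum>a<d. w $ a * v i $ a)\<^sup>2)"
proof -
  have "w \<bullet> (weighted_gram d m v x *\<^sub>v w) =
      (\<Sum>a<d. \<Sum>b<d. \<Sum>i<m. x $ i * ((w $ a * v i $ a) * (w $ b * v i $ b)))"
    using w by (simp add: weighted_gram_def scalar_prod_def atLeast0LessThan sum_distrib_left
        sum_distrib_right mult_ac)
  also have "\<dots> = (\<Sum>a<d. \<Sum>i<m. \<Sum>b<d. x $ i * ((w $ a * v i $ a) * (w $ b * v i $ b)))"
    by (rule sum.cong[OF refl], rule sum.swap)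
  also have "\<dots> = (\<Sum>i<m. \<Sum>a<d. \<Sum>b<d. x $ i * ((w $ a * v i $ a) * (w $ b * v i $ b)))"
    by (rule sum.swap)
  also have "\<dots> = (\<Sum>i<m. x $ i * (\<Sum>a<d. w $ a * v i $ a)\<^sup>2)"
    unfolding power2_eq_square sum_product by (simp add: sum_distrib_left)
  finally show ?thesis .
qed

text \<open>For z > 0 a kernel vector of z I + G would contradict the nonnegative quadratic form of
  G, so det (z I + G) has no positive root. Being positive for large z, it cannot be negative at z =
  0 by the intermediate value theorem.\<close>

lemma det_weighted_gram_nonneg:
  assumes x: "\<And>i. i < m \<Longrightarrow> x $ i \<ge> 0"
  shows "det (weighted_gram d m v x) \<ge> 0"
proof -
  define G where "G = weighted_gram d m v x"
  have G: "G \<in> carrier_mat d d" by (simp add: G_def)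
  have nz: "poly (shifted_det G) z \<noteq> 0" if z: "z > 0" for z
  proof
    assume "poly (shifted_det G) z = 0"
    then obtain w where w: "w \<in> carrier_vec d" "w \<noteq> 0\<^sub>v d" "(z \<cdot>\<^sub>m 1\<^sub>m d + G) *\<^sub>v w = 0\<^sub>v d"
      using det_0_iff_vec_prod_zero[of "z \<cdot>\<^sub>m 1\<^sub>m d + G" d] G by (auto simp: poly_shifted_det[OF G])
    have "(z \<cdot>\<^sub>m 1\<^sub>m d + G) *\<^sub>v w = z \<cdot>\<^sub>v w + G *\<^sub>v w"
      using w G by (subst add_mult_distrib_mat_vec) auto
    then have "0 = w \<bullet> (z \<cdot>\<^sub>v w + G *\<^sub>v w)"
      using w(1) unfolding w(3) by (metis scalar_prod_right_zero)
    also have "\<dots> = z * (w \<bullet> w) + w \<bullet> (G *\<^sub>v w)"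
      using w G by (subst scalar_prod_add_distrib[of _ d]) auto
    finally have "z * (w \<bullet> w) = - (\<Sum>i<m. x $ i * (\<Sum>a<d. w $ a * v i $ a)\<^sup>2)"
      using weighted_gram_quadratic_form[OF w(1)] by (simp add: G_def)
    also have "\<dots> \<le> 0" using x by (auto intro!: sum_nonneg)
    finally have "w \<bullet> w \<le> 0" using z by (simp add: mult_le_0_iff)
    moreover have "w \<bullet> w > 0"
    proof -
      obtain a where a: "a < d" "w $ a \<noteq> 0" using w by (metis carrier_vecD eq_vecI index_zero_vec)
      have "w \<bullet> w = (\<Sum>b<d. (w $ b)\<^sup>2)"
        using w by (simp add: scalar_prod_def atLeast0LessThan power2_eq_square)
      also have "\<dots> > 0" using a by (intro sum_pos2[of _ a]) auto
      finally show ?thesis .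
    qed
    ultimately show False by simp
  qed
  obtain n where n: "\<And>y. y \<ge> n \<Longrightarrow> poly (shifted_det G) y \<ge> 1"
    using poly_pinfty_gt_lc[of "shifted_det G"] shifted_det_monic[OF G] by auto
  have "det G = poly (shifted_det G) 0" by (simp add: poly_shifted_det_0[OF G])
  moreover have "poly (shifted_det G) 0 \<ge> 0"
  proof (rule ccontr)
    assume "\<not> poly (shifted_det G) 0 \<ge> 0"
    then have "\<exists>z>0. z < max 1 n \<and> poly (shifted_det G) z = 0"
      using n[of "max 1 n"] by (intro poly_IVT_pos) auto
    with nz show False by blast
  qed
  ultimately show ?thesis by (simp add: G_def)
qed

lemma sum_mset_eq_sum_count:
  fixes f :: "nat \<Rightarrow> real"
  assumes "set_mset S \<subseteq> {..<m}"
  shows "(\<Sum>i\<in>#S. f i) = (\<Sum>i<m. real (count S i) * f i)"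
  using assms
proof (induction S)
  case (add j S)
  have "(\<Sum>i<m. real (count (add_mset j S) i) * f i) =
      (\<Sum>i<m. (if i = j then f i else 0) + real (count S i) * f i)"
    by (intro sum.cong) (auto simp: algebra_simps)
  with add show ?case by (simp add: sum.distrib)
qed simp

lemma multiset_gram_eq_weighted_gram:
  assumes "set_mset S \<subseteq> {..<m}"
  shows "multiset_gram d v S = weighted_gram d m v (vec m (\<lambda>i. real (count S i)))"
  unfolding multiset_gram_def weighted_gram_def
  by (intro eq_matI) (auto simp: sum_mset_eq_sum_count[OF assms] intro!: sum.cong)

text \<open>The multiplicities of a discrete solution form a feasible point of the relaxation with
  the same matrix.\<close>

lemma relaxation_lower_bound:
  assumes opt: "relaxation_optimal d m k v x"
  shows "D_objective d (weighted_gram d m v x) \<le> D_design_opt d m k v"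
  unfolding D_design_opt_def
proof (rule INF_greatest)
  fix S assume "S \<in> D_design_solutions m k"
  then have S: "size S = k" "set_mset S \<subseteq> {..<m}" by (auto simp: D_design_solutions_def)
  have "real (size S) = (\<Sum>i<m. real (count S i))"
    using sum_mset_eq_sum_count[OF S(2), of "\<lambda>_. 1"] by simp
  then have "relaxation_feasible m k (vec m (\<lambda>i. real (count S i)))"
    using S by (simp add: relaxation_feasible_def)
  then show "D_objective d (weighted_gram d m v x) \<le> D_objective d (multiset_gram d v S)"
    using opt by (simp add: relaxation_optimal_def multiset_gram_eq_weighted_gram[OF S(2)])
qed

text \<open>The power -1/d reverses the bound, and the constant c = k! / ((k-d)! k^d) becomes
  c^(-1/d) = k ((k-d)! / k!)^(1/d).\<close>

lemma D_objective_le: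
  assumes d: "d \<ge> 1" "d \<le> k"
    and bound: "fact k / (fact (k - d) * real k ^ d) * det X \<le> det Y"
  shows "D_objective d Y \<le> ereal (real k * (fact (k - d) / fact k) powr (1 / real d)) * D_objective d X"
proof (cases "det X > 0")
  case True
  define c :: real where "c = fact k / (fact (k - d) * real k ^ d)"
  have k: "real k > 0" using d by simp
  have c: "c > 0" using k by (simp add: c_def)
  have pos: "0 < c * det X" using c True by simp
  have Y: "c * det X \<le> det Y" using bound by (simp add: c_def)
  have "det Y powr (- 1 / real d) \<le> (c * det X) powr (- 1 / real d)"
    using Y pos by (intro powr_mono2') auto
  also have "\<dots> = c powr (- 1 / real d) * det X powr (- 1 / real d)"
    using c True by (simp add: powr_mult)
  also have "c powr (- 1 / real d) = (1 / c) powr (1 / real d)"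
    using c by (simp add: powr_divide powr_minus_divide)
  also have "1 / c = (fact (k - d) / fact k) * real k powr real d"
    using k by (simp add: c_def powr_realpow)
  also have "\<dots> powr (1 / real d) = (fact (k - d) / fact k) powr (1 / real d) * real k"
    using k d by (subst powr_mult) (auto simp: powr_powr)
  finally show ?thesis using True Y pos by (simp add: D_objective_def mult_ac)
next
  case False
  \<comment> \<open>Positivity matters: in \<open>ereal\<close> the product of 0 and \<infinity> is
    0, which would not bound the left side.\<close>
  have "real k * (fact (k - d) / fact k) powr (1 / real d) > 0" using d by simp
  then show ?thesis using False d by (simp add: D_objective_def)
qed

text \<open>The matrix factors through dimension m < d. Padding both factors with zeros to size d
  leaves row \<open>m\<close> of \<open>A\<close> zero.\<close>

lemma det_weighted_gram_few_vectors:
  assumes "m < d"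
  shows "det (weighted_gram d m v x) = 0"
proof -
  define A where "A = mat d d (\<lambda>(i, b). if i < m then x $ i * v i $ b else 0)"
  define C where "C = mat d d (\<lambda>(a, i). if i < m then v i $ a else 0)"
  have "weighted_gram d m v x = C * A"
  proof (rule eq_matI)
    fix a b assume "a < dim_row (C * A)" "b < dim_col (C * A)"
    then have ab: "a < d" "b < d" by (auto simp: A_def C_def)
    then have "(C * A) $$ (a, b) = (\<Sum>i<d. if i < m then x $ i * (v i $ a * v i $ b) else 0)"
      by (auto simp: A_def C_def scalar_prod_def atLeast0LessThan intro!: sum.cong)
    also have "\<dots> = (\<Sum>i<m. x $ i * (v i $ a * v i $ b))"
      using assms by (intro sum.mono_neutral_cong_right) auto
    finally show "weighted_gram d m v x $$ (a, b) = (C * A) $$ (a, b)"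
      using ab by (simp add: weighted_gram_def)
  qed (auto simp: weighted_gram_def A_def C_def)
  moreover have "det A = 0"
  proof -
    have A: "A \<in> carrier_mat d d" by (simp add: A_def)
    have "row A m = 0\<^sub>v d" using assms by (intro eq_vecI) (auto simp: A_def)
    \<comment> \<open>The unit vector with index \<open>m\<close> lies in the kernel of the
      transpose.\<close>
    then have "det (transpose_mat A) = 0"
      using assms by (subst det_0_iff_vec_prod_zero[of _ d])
        (auto simp: A_def scalar_prod_def intro!: exI[of _ "unit_vec d m"] eq_vecI sum.neutral)
    then show ?thesis using det_transpose[OF A] by simp
  qed
  moreover have "det (C * A) = det C * det A" by (rule det_mult[of _ d]) (auto simp: A_def C_def)
  ultimately show ?thesis by simp
qed

text \<open>The row v_i^T Y with Y = k X^(-1), written with the adjugate because the program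
  computes it so. For det X = 0, division by 0 makes it 0.\<close>

definition dual_vec :: "nat \<Rightarrow> nat \<Rightarrow> nat \<Rightarrow> (nat \<Rightarrow> real vec) \<Rightarrow> real vec \<Rightarrow> nat \<Rightarrow> nat \<Rightarrow> real" where
  "dual_vec d m k v x i b = (let X = weighted_gram d m v x in
     \<Sum>c<d. v i $ c * (real k * adj_mat X $$ (c, b) / det X))"

text \<open>With p_i = x_i / k, the identity X Y = k I is the isotropy that
  \<open>greedy_det_ge\<close> demands. As \<open>B k\<close> is the selected Gram matrix times Y
  and det Y = k^d / det X, the bound transfers.\<close>

lemma greedy_rounding_bound:
  assumes d: "d \<ge> 1" "d \<le> k"
    and x: "\<And>i. i < m \<Longrightarrow> x $ i \<ge> 0" "(\<Sum>i<m. x $ i) = real k"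
    and s: "\<And>t. t < k \<Longrightarrow> s t < m"
    and udef: "u = dual_vec d m k v x"
    and Bdef: "\<And>t. B t = mat d d (\<lambda>(a, b). \<Sum>l<t. v (s l) $ a * u (s l) b)"
    and greedy: "\<And>t i. t < k \<Longrightarrow> i < m \<Longrightarrow>
      gain d (k - 1 - t) (B t) (u i) (\<lambda>b. v i $ b) \<le>
      gain d (k - 1 - t) (B t) (u (s t)) (\<lambda>b. v (s t) $ b)"
  shows "fact k / (fact (k - d) * real k ^ d) * det (weighted_gram d m v x)
    \<le> det (multiset_gram d v (mset (map s [0..<k])))"
proof (cases "det (weighted_gram d m v x) > 0")
  case False
  \<comment> \<open>Here the left side is at most 0, while Gram matrices of multisets have
    nonnegative determinant.\<close>
  have "set_mset (mset (map s [0..<k])) \<subseteq> {..<m}" using s by auto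
  then have "det (multiset_gram d v (mset (map s [0..<k]))) \<ge> 0"
    by (subst multiset_gram_eq_weighted_gram) (auto intro: det_weighted_gram_nonneg)
  moreover have "fact k / (fact (k - d) * real k ^ d) * det (weighted_gram d m v x) \<le> 0"
    using False by (intro mult_nonneg_nonpos) auto
  ultimately show ?thesis by linarith
next
  case True
  define X where "X = weighted_gram d m v x"
  define Y where "Y = (real k / det X) \<cdot>\<^sub>m adj_mat X"
  define A where "A = multiset_gram d v (mset (map s [0..<k]))"
  have k: "real k > 0" using d by simp
  have X: "X \<in> carrier_mat d d" "det X > 0" using True by (auto simp: X_def)
  have Y: "Y \<in> carrier_mat d d" using adj_mat(1)[OF X(1)] by (simp add: Y_def)
  have A: "A \<in> carrier_mat d d" by (simp add: A_def)
  have "X * Y = (real k / det X) \<cdot>\<^sub>m (X * adj_mat X)"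
    unfolding Y_def by (rule mult_smult_distrib) (use X adj_mat in auto)
  also have "\<dots> = real k \<cdot>\<^sub>m 1\<^sub>m d"
    unfolding adj_mat(2)[OF X(1)] using X(2) by (intro eq_matI) auto
  finally have XY: "X * Y = real k \<cdot>\<^sub>m 1\<^sub>m d" .
  then have "det X * det Y = real k ^ d"
    using det_mult[OF X(1) Y] by simp
  then have detY: "det Y = real k ^ d / det X" using X(2) by (simp add: field_simps)
  have u: "u i b = (\<Sum>c<d. v i $ c * Y $$ (c, b))" if "b < d" for i b
    using that X(1) unfolding udef dual_vec_def Y_def X_def[symmetric] Let_def
    by (intro sum.cong) auto
  have iso: "(\<Sum>i<m. x $ i / real k * (v i $ a * u i b)) = (if a = b then 1 else 0)"
    if ab: "a < d" "b < d" for a b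
  proof -
    have "(\<Sum>i<m. x $ i / real k * (v i $ a * u i b)) =
        (\<Sum>i<m. \<Sum>c<d. (x $ i * (v i $ a * v i $ c)) * Y $$ (c, b) / real k)"
      using ab by (simp add: u sum_distrib_left sum_distrib_right mult_ac)
    also have "\<dots> = (\<Sum>c<d. \<Sum>i<m. (x $ i * (v i $ a * v i $ c)) * Y $$ (c, b) / real k)"
      by (rule sum.swap)
    also have "\<dots> = (\<Sum>c<d. X $$ (a, c) * Y $$ (c, b)) / real k"
      using ab by (simp add: X_def weighted_gram_def sum_distrib_right sum_divide_distrib)
    also have "(\<Sum>c<d. X $$ (a, c) * Y $$ (c, b)) = (X * Y) $$ (a, b)"
      using ab X Y by (auto simp: scalar_prod_def atLeast0LessThan)
    finally show ?thesis using k ab by (simp add: XY)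
  qed
  have AY: "B k = A * Y"
  proof (rule eq_matI)
    fix a b assume "a < dim_row (A * Y)" "b < dim_col (A * Y)"
    then have ab: "a < d" "b < d" using A Y by auto
    have "(A * Y) $$ (a, b) = (\<Sum>c<d. A $$ (a, c) * Y $$ (c, b))"
      using ab A Y by (auto simp: scalar_prod_def atLeast0LessThan)
    also have "\<dots> = (\<Sum>c<d. \<Sum>l<k. (v (s l) $ a * v (s l) $ c) * Y $$ (c, b))"
    proof (rule sum.cong[OF refl])
      fix c assume "c \<in> {..<d}"
      moreover have "(\<Sum>i\<in>#mset (map s [0..<k]). v i $ a * v i $ c) = (\<Sum>l<k. v (s l) $ a * v (s l) $ c)"
        by (simp add: image_mset.compositionality o_def sum_unfold_sum_mset atLeast0LessThan)
      ultimately show "A $$ (a, c) * Y $$ (c, b) = (\<Sum>l<k. (v (s l) $ a * v (s l) $ c) * Y $$ (c, b))"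
        using ab by (simp add: A_def multiset_gram_def sum_distrib_right)
    qed
    also have "\<dots> = (\<Sum>l<k. \<Sum>c<d. (v (s l) $ a * v (s l) $ c) * Y $$ (c, b))"
      by (rule sum.swap)
    also have "\<dots> = (\<Sum>l<k. v (s l) $ a * u (s l) b)"
      using ab by (simp add: u sum_distrib_left mult_ac)
    finally show "B k $$ (a, b) = (A * Y) $$ (a, b)" using ab by (simp add: Bdef)
  qed (use A Y in \<open>auto simp: Bdef\<close>)
  have "falling k d \<le> det (B k)"
  proof (rule greedy_det_ge[where p = "\<lambda>i. x $ i / real k" and v = "\<lambda>i a. v i $ a" and u = u and s = s and m = m])
    show "(\<Sum>i<m. x $ i / real k) = 1" using x(2) k by (simp flip: sum_divide_distrib)
  qed (use x k iso Bdef greedy in \<open>auto\<close>)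
  then have "fact k / fact (k - d) \<le> det A * (real k ^ d / det X)"
    using d by (simp add: falling_eq_fact AY det_mult[OF A Y] detY)
  then show ?thesis using k X(2) by (simp add: A_def X_def field_simps)
qed

section \<open>The matrix multiplication exponent is at least 2\<close>

lemma slp_run_append: "slp_run (gs @ hs) ys = slp_run hs (slp_run gs ys)"
  by (induction gs arbitrary: ys) auto

lemma length_slp_run [simp]: "length (slp_run gs ys) = length ys + length gs"
  by (induction gs arbitrary: ys) auto

lemma nth_default_slp_run:
  "i < length ys \<Longrightarrow> nth_default 0 (slp_run gs ys) i = nth_default 0 ys i"
proof (induction gs arbitrary: ys)
  case (Cons g gs)
  have "nth_default 0 (slp_run (g # gs) ys) i = nth_default 0 (ys @ [gate_val g ys]) i"
    using Cons by simp
  also have "\<dots> = nth_default 0 ys i"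
    using Cons.prems by (simp add: nth_default_def nth_append)
  finally show ?case .
qed simp

lemma concat_map_upt:
  "concat (map (\<lambda>i. map (f i) [0..<n]) [0..<m]) = map (\<lambda>p. f (p div n) (p mod n)) [0..<m * n]"
proof (induction m)
  case (Suc m)
  have "[0..<Suc m * n] = [0..<m * n] @ map (\<lambda>j. m * n + j) [0..<n]"
    using upt_add_eq_append[of 0 "m * n" n] map_add_upt[of "m * n" n] by (simp add: add.commute)
  with Suc show ?case by (cases "n = 0") (auto simp: div_add1_eq)
qed simp

lemma concat_mat_to_list:
  assumes "A \<in> carrier_mat n n"
  shows "concat (mat_to_list A) = map (\<lambda>p. A $$ (p div n, p mod n)) [0..<n * n]"
  using assms concat_map_upt[of "\<lambda>i j. A $$ (i, j)" n n] by (simp add: mat_to_list_def)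

lemma index_pair_less: "i < n \<Longrightarrow> j < n \<Longrightarrow> i * n + j < n * n" for i j n :: nat
proof -
  assume "i < n" "j < n"
  then have "i * n + j < Suc i * n" "Suc i * n \<le> n * n" using mult_le_mono1[of "Suc i" n n] by auto
  then show ?thesis by linarith
qed

text \<open>The n^2 output positions are pairwise distinct and belong to gates, not to
  inputs.\<close>

lemma length_slp_ge:
  assumes mult: "slp_multiplies n gs out"
  shows "n * n \<le> length gs"
proof -
  define ys where "ys A B = concat (mat_to_list A) @ concat (mat_to_list B)" for A B :: "real mat"
  have len: "length (ys A B) = 2 * (n * n)" if "A \<in> carrier_mat n n" "B \<in> carrier_mat n n" for A B
    using that by (simp add: ys_def concat_mat_to_list)
  have run: "nth_default 0 (slp_run gs (ys A B)) (out i j) = (\<Sum>c<n. A $$ (i, c) * B $$ (c, j))"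
    if "A \<in> carrier_mat n n" "B \<in> carrier_mat n n" "i < n" "j < n" for A B i j
    using mult that by (auto simp: slp_multiplies_def ys_def scalar_prod_def atLeast0LessThan)
  define J :: "real mat" where "J = mat n n (\<lambda>_. 1)"
  have J: "J \<in> carrier_mat n n" by (simp add: J_def)
  have ran: "out i j \<in> {2 * (n * n)..<2 * (n * n) + length gs}" if ij: "i < n" "j < n" for i j
  proof (rule ccontr)
    assume "\<not> ?thesis"
    then consider "out i j < n * n" | "n * n \<le> out i j" "out i j < 2 * (n * n)"
      | "2 * (n * n) + length gs \<le> out i j" by fastforce
    then show False
    proof cases
      \<comment> \<open>An input cell of the first factor reads 1 if that factor is all ones,
        although its product with 0 is 0. The second case is symmetric.\<close>
      case 1
      have "nth_default 0 (slp_run gs (ys J (0\<^sub>m n n))) (out i j) = 0"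
        using run[OF J _ ij, of "0\<^sub>m n n"] ij by simp
      moreover have "nth_default 0 (slp_run gs (ys J (0\<^sub>m n n))) (out i j) = J $$ (out i j div n, out i j mod n)"
        using 1 len[OF J, of "0\<^sub>m n n"] J
        by (subst nth_default_slp_run) (auto simp: ys_def concat_mat_to_list nth_default_append nth_default_nth)
      ultimately show False using 1 ij by (simp add: J_def less_mult_imp_div_less)
    next
      case 2
      have "nth_default 0 (slp_run gs (ys (0\<^sub>m n n) J)) (out i j) = 0"
        using run[OF _ J ij, of "0\<^sub>m n n"] ij by simp
      moreover have "nth_default 0 (slp_run gs (ys (0\<^sub>m n n) J)) (out i j) =
          J $$ ((out i j - n * n) div n, (out i j - n * n) mod n)"
        using 2 len[OF _ J, of "0\<^sub>m n n"] J
        by (subst nth_default_slp_run) (auto simp: ys_def concat_mat_to_list nth_default_append nth_default_nth)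
      moreover have "(out i j - n * n) div n < n" using 2 by (intro less_mult_imp_div_less) auto
      ultimately show False using ij by (simp add: J_def)
    next
      \<comment> \<open>Beyond the end the default 0 is read, but the entries of
        \<open>J * J\<close> are n > 0.\<close>
      case 3
      then have "nth_default 0 (slp_run gs (ys J J)) (out i j) = 0"
        using len[OF J J] by (simp add: nth_default_beyond)
      then show False using run[OF J J ij] ij by (simp add: J_def)
    qed
  qed
  have inj: "inj_on (\<lambda>(i, j). out i j) ({..<n} \<times> {..<n})"
  proof (rule inj_onI, clarsimp)
    fix i j i' j' assume ij: "i < n" "j < n" "i' < n" "j' < n" "out i j = out i' j'"
    \<comment> \<open>With ones in row \<open>i\<close> of \<open>A\<close> and column
      \<open>j\<close> of \<open>B\<close>, the product is n at (i, j) and 0 elsewhere, which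
      separates the outputs.\<close>
    define A where "A = mat n n (\<lambda>(a, c). if a = i then 1 else 0 :: real)"
    define B where "B = mat n n (\<lambda>(c, b). if b = j then 1 else 0 :: real)"
    have AB: "A \<in> carrier_mat n n" "B \<in> carrier_mat n n" by (auto simp: A_def B_def)
    have "(\<Sum>c<n. A $$ (i, c) * B $$ (c, j)) = (\<Sum>c<n. A $$ (i', c) * B $$ (c, j'))"
      using run[OF AB ij(1,2)] run[OF AB ij(3,4)] ij(5) by simp
    then show "i = i' \<and> j = j'"
      using ij by (auto simp: A_def B_def split: if_splits)
  qed
  have "card ({..<n} \<times> {..<n}) \<le> card {2 * (n * n)..<2 * (n * n) + length gs}"
    using ran by (intro card_inj_on_le[OF inj]) auto
  then show ?thesis by simp
qed

text \<open>A constant 0 is followed by one product and one addition per term, so the running sum is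
  always the last cell.\<close>

lemma slp_scalar_product:
  assumes "\<And>c. f c < M" "\<And>c. g c < M"
  shows "\<exists>gs. length gs = 2 * N + 1 \<and> (\<forall>ys. length ys = M \<longrightarrow>
    nth_default 0 (slp_run gs ys) (M + 2 * N) = (\<Sum>c<N. nth_default 0 ys (f c) * nth_default 0 ys (g c)))"
proof (induction N)
  case 0
  show ?case by (intro exI[of _ "[GConst 0]"]) (auto simp: nth_default_append nth_default_beyond)
next
  case (Suc N)
  then obtain gs where gs: "length gs = 2 * N + 1" "\<And>ys. length ys = M \<Longrightarrow>
    nth_default 0 (slp_run gs ys) (M + 2 * N) = (\<Sum>c<N. nth_default 0 ys (f c) * nth_default 0 ys (g c))"
    by auto
  let ?hs = "gs @ [GMul (f N) (g N), GAdd (M + 2 * N) (M + 2 * N + 1)]"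
  have "nth_default 0 (slp_run ?hs ys) (M + 2 * Suc N) =
      (\<Sum>c<Suc N. nth_default 0 ys (f c) * nth_default 0 ys (g c))" if ys: "length ys = M" for ys
  proof -
    have "nth_default 0 (slp_run gs ys) (f N) = nth_default 0 ys (f N)"
      "nth_default 0 (slp_run gs ys) (g N) = nth_default 0 ys (g N)"
      using assms ys by (auto intro: nth_default_slp_run)
    then show ?thesis
      using gs(1) gs(2)[OF ys] ys by (simp add: slp_run_append nth_default_append nth_default_nth)
  qed
  then show ?case using gs(1) by (intro exI[of _ ?hs]) auto
qed

text \<open>Programs for single scalar products are concatenated. Their operands are inputs, so each
  also works on the longer memory left by its predecessors; the bound on \<open>out q\<close> keeps
  earlier results in place.\<close>

lemma slp_scalar_products:
  assumes "finite F" "\<And>q c. f q c < M" "\<And>q c. g q c < M"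
  shows "\<exists>gs out. length gs = (2 * N + 1) * card F \<and> (\<forall>ys. length ys = M \<longrightarrow> (\<forall>q\<in>F.
    out q < M + length gs \<and>
    nth_default 0 (slp_run gs ys) (out q) = (\<Sum>c<N. nth_default 0 ys (f q c) * nth_default 0 ys (g q c))))"
  using assms(1)
proof (induction F)
  case (insert p F)
  then obtain gs out where gs: "length gs = (2 * N + 1) * card F"
    "\<forall>ys. length ys = M \<longrightarrow> (\<forall>q\<in>F. out q < M + length gs \<and>
      nth_default 0 (slp_run gs ys) (out q) =
        (\<Sum>c<N. nth_default 0 ys (f q c) * nth_default 0 ys (g q c)))"
    by (elim exE conjE) (rule that)
  obtain hs where hs: "length hs = 2 * N + 1" "\<And>ys. length ys = M + length gs \<Longrightarrow>
    nth_default 0 (slp_run hs ys) (M + length gs + 2 * N) =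
      (\<Sum>c<N. nth_default 0 ys (f p c) * nth_default 0 ys (g p c))"
    using slp_scalar_product[of "f p" "M + length gs" "g p" N] assms(2,3) by (metis trans_less_add1)
  define out' where "out' = out(p := M + length gs + 2 * N)"
  have "out' q < M + length (gs @ hs) \<and> nth_default 0 (slp_run (gs @ hs) ys) (out' q) =
      (\<Sum>c<N. nth_default 0 ys (f q c) * nth_default 0 ys (g q c))"
    if "length ys = M" "q \<in> insert p F" for ys q
  proof (cases "q = p")
    case True
    then show ?thesis
      using hs that assms(2,3) by (simp add: out'_def slp_run_append nth_default_slp_run)
  next
    case False
    then have "q \<in> F" using that by simp
    then have "out q < M + length gs" using gs(2) that(1) by blast
    moreover from this have "out q < M + (length gs + length hs)" by simp
    ultimately show ?thesis
      using False \<open>q \<in> F\<close> gs(2) that(1) by (simp add: out'_def slp_run_append nth_default_slp_run)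
  qed
  moreover have "length (gs @ hs) = (2 * N + 1) * card (insert p F)"
    using insert gs(1) hs(1) by simp
  ultimately show ?case by (intro exI[of _ "gs @ hs"] exI[of _ out']) auto
qed auto

text \<open>It makes the set in the definition of \<omega> nonempty, as a lower bound on its infimum
  requires.\<close>

lemma slp_multiplies_naive:
  "\<exists>gs out. slp_multiplies n gs out \<and> length gs = (2 * n + 1) * (n * n)"
proof (cases "n = 0")
  case True
  then show ?thesis by (auto simp: slp_multiplies_def intro: exI[of _ "[]"])
next
  case False
  \<comment> \<open>The fallback 0 keeps operand positions in range for all arguments, as
    \<open>slp_scalar_products\<close> demands.\<close>
  define f where "f q c = (if fst q < n \<and> c < n then fst q * n + c else 0)" for q :: "nat \<times> nat" and c
  define g where "g q c = (if snd q < n \<and> c < n then n * n + (c * n + snd q) else 0)" for q :: "nat \<times> nat" and c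
  have fg: "f q c < 2 * (n * n)" "g q c < 2 * (n * n)" for q c
    using False index_pair_less[of "fst q" n c] index_pair_less[of c n "snd q"] by (auto simp: f_def g_def)
  obtain gs out where len: "length gs = (2 * n + 1) * (n * n)" and gs: "\<forall>ys. length ys = 2 * (n * n) \<longrightarrow>
      (\<forall>q\<in>{..<n} \<times> {..<n}. out q < 2 * (n * n) + length gs \<and>
        nth_default 0 (slp_run gs ys) (out q) =
        (\<Sum>c<n. nth_default 0 ys (f q c) * nth_default 0 ys (g q c)))"
    using slp_scalar_products[of "{..<n} \<times> {..<n}" f "2 * (n * n)" g n, OF _ fg]
    unfolding card_cartesian_product card_lessThan by blast
  have "slp_multiplies n gs (\<lambda>i j. out (i, j))"
    unfolding slp_multiplies_def
  proof (intro ballI allI impI)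
    fix A B :: "real mat" and i j
    assume AB: "A \<in> carrier_mat n n" "B \<in> carrier_mat n n" and ij: "i < n" "j < n"
    let ?ys = "concat (mat_to_list A) @ concat (mat_to_list B)"
    have "nth_default 0 (slp_run gs ?ys) (out (i, j)) =
        (\<Sum>c<n. nth_default 0 ?ys (f (i, j) c) * nth_default 0 ?ys (g (i, j) c))"
      using AB ij gs[rule_format, of ?ys "(i, j)"] by (simp add: concat_mat_to_list)
    also have "\<dots> = (\<Sum>c<n. A $$ (i, c) * B $$ (c, j))"
      using AB ij index_pair_less[of i n] index_pair_less[of _ n j]
      by (intro sum.cong) (auto simp: concat_mat_to_list f_def g_def nth_default_append nth_default_nth)
    also have "\<dots> = (A * B) $$ (i, j)"
      using AB ij by (auto simp: scalar_prod_def atLeast0LessThan)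
    finally show "nth_default 0 (slp_run gs ?ys) (out (i, j)) = (A * B) $$ (i, j)" .
  qed
  with len show ?thesis by blast
qed

text \<open>From n^2 <= C n^\<tau> for all n >= 1 it follows that n^(2-\<tau>) is bounded, which
  forces \<tau> >= 2.\<close>

lemma matmul_exponent_ge_2: "\<omega> \<ge> 2"
  unfolding matmul_exponent_def
proof (rule cInf_greatest)
  have "\<exists>gs out. slp_multiplies n gs out \<and> real (length gs) \<le> 3 * real n powr 3" if n: "n \<ge> 1" for n
  proof -
    obtain gs out where gs: "slp_multiplies n gs out" "length gs = (2 * n + 1) * (n * n)"
      using slp_multiplies_naive by blast
    have "length gs \<le> (3 * n) * (n * n)" unfolding gs(2) using n by (intro mult_right_mono) auto
    then have "real (length gs) \<le> real (3 * n * (n * n))" by (rule of_nat_mono)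
    also have "\<dots> = 3 * real n powr 3" using n by (simp add: powr_numeral power3_eq_cube)
    finally show ?thesis using gs(1) by blast
  qed
  then show "{\<tau>. \<exists>C. \<forall>n\<ge>1. \<exists>gs out. slp_multiplies n gs out \<and> real (length gs) \<le> C * real n powr \<tau>} \<noteq> {}"
    by blast
next
  fix \<tau> assume "\<tau> \<in> {\<tau>. \<exists>C. \<forall>n\<ge>1. \<exists>gs out. slp_multiplies n gs out \<and> real (length gs) \<le> C * real n powr \<tau>}"
  then obtain C where C: "\<And>n. n \<ge> 1 \<Longrightarrow> \<exists>gs out. slp_multiplies n gs out \<and> real (length gs) \<le> C * real n powr \<tau>"
    by blast
  have bound: "real n powr (2 - \<tau>) \<le> C" if n: "n \<ge> 1" for n
  proof -
    obtain gs out where "slp_multiplies n gs out" "real (length gs) \<le> C * real n powr \<tau>"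
      using C[OF n] by blast
    then have "real (n * n) \<le> C * real n powr \<tau>" using length_slp_ge by (meson of_nat_le_iff order_trans)
    moreover have "real (n * n) = real n powr (2 - \<tau>) * real n powr \<tau>"
      using n by (simp add: powr_add[symmetric] powr_numeral power2_eq_square)
    ultimately show ?thesis using n by simp
  qed
  show "2 \<le> \<tau>"
  proof (rule ccontr)
    assume "\<not> 2 \<le> \<tau>"
    then have e: "2 - \<tau> > 0" by simp
    obtain n :: nat where n: "real n > (\<bar>C\<bar> + 1) powr (1 / (2 - \<tau>))" using reals_Archimedean2 by blast
    then have "n \<ge> 1" by (cases n) (auto simp: not_less[symmetric])
    have "\<bar>C\<bar> + 1 = ((\<bar>C\<bar> + 1) powr (1 / (2 - \<tau>))) powr (2 - \<tau>)"
      using e by (simp add: powr_powr)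
    also have "\<dots> < real n powr (2 - \<tau>)" using n e by (intro powr_less_mono2) auto
    finally show False using bound[OF \<open>n \<ge> 1\<close>] by simp
  qed
qed

section \<open>Loops with time bounds\<close>

abbreviation nvar :: "name \<Rightarrow> nexp" where
  "nvar a \<equiv> NGet a (NConst 0) (NConst 0)"

abbreviation rvar :: "name \<Rightarrow> rexp" where
  "rvar a \<equiv> RGet a (NConst 0) (NConst 0)"

definition For :: "name \<Rightarrow> nexp \<Rightarrow> com \<Rightarrow> com" where
  "For i n P = Seq (NPut i (NConst 0) (NConst 0) (NConst 0))
     (While (NLess (nvar i) n)
       (Seq P (NPut i (NConst 0) (NConst 0) (NAdd (nvar i) (NConst 1)))))"

definition set_nvar :: "name \<Rightarrow> nat \<Rightarrow> state \<Rightarrow> state" where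
  "set_nvar i n s = (put (fst s) i 0 0 n, snd s)"

lemma put_apply: "put f a i j y b k l = (if b = a \<and> k = i \<and> l = j then y else f b k l)"
  by (simp add: put_def)

lemma exec_NPutI:
  "t = 1 + ncost i + ncost j + ncost e \<Longrightarrow>
    s' = (put (fst s) a (nval i s) (nval j s) (nval e s), snd s) \<Longrightarrow> exec (NPut a i j e) s t s'"
  using exec.NPut by simp

lemma exec_RPutI:
  "t = 1 + ncost i + ncost j + rcost e \<Longrightarrow>
    s' = (fst s, put (snd s) a (nval i s) (nval j s) (rval e s)) \<Longrightarrow> exec (RPut a i j e) s t s'"
  using exec.RPut by simp

text \<open>A round costs \<open>T\<close> for the body, 5 + \<open>ncost n\<close> for the test and
  8 for the increment. The bound expression is re-evaluated at each test, so the invariant has to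
  fix its value.\<close>

lemma exec_While:
  assumes step: "\<And>j s. j < N \<Longrightarrow> I j s \<Longrightarrow> fst s i 0 0 = j \<Longrightarrow>
      \<exists>t s'. exec P s t s' \<and> t \<le> T \<and> fst s' i 0 0 = j \<and> I (Suc j) (set_nvar i (Suc j) s')"
    and bound: "\<And>j s. j \<le> N \<Longrightarrow> I j s \<Longrightarrow> nval n s = N"
    and init: "I j s" "fst s i 0 0 = j" "j \<le> N"
  shows "\<exists>t s'. exec (While (NLess (nvar i) n)
      (Seq P (NPut i (NConst 0) (NConst 0) (NAdd (nvar i) (NConst 1))))) s t s' \<and>
    t \<le> (N - j) * (T + 13 + ncost n) + (5 + ncost n) \<and> I N s'"
  using init
proof (induction "N - j" arbitrary: j s)
  case 0
  then have j: "j = N" by simp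
  have "exec (While (NLess (nvar i) n)
      (Seq P (NPut i (NConst 0) (NConst 0) (NAdd (nvar i) (NConst 1))))) s
      (1 + bcost (NLess (nvar i) n)) s"
    using 0 bound[of j s] j by (intro exec.WhileFalse) simp
  then show ?case using 0 j by (intro exI conjI) auto
next
  case (Suc e)
  then have j: "j < N" by simp
  obtain t s' where s': "exec P s t s'" "t \<le> T" "fst s' i 0 0 = j" "I (Suc j) (set_nvar i (Suc j) s')"
    using step[OF j Suc.prems(1,2)] by blast
  have "exec (NPut i (NConst 0) (NConst 0) (NAdd (nvar i) (NConst 1))) s' 8 (set_nvar i (Suc j) s')"
    using s'(3) by (intro exec_NPutI) (simp_all add: set_nvar_def)
  note body = exec.Seq[OF s'(1) this]
  have "e = N - Suc j" "fst (set_nvar i (Suc j) s') i 0 0 = Suc j" "Suc j \<le> N"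
    using Suc.hyps(2) j by (auto simp: set_nvar_def put_apply)
  from Suc.hyps(1)[OF this(1) s'(4) this(2,3)] obtain t' s'' where
    s'': "exec (While (NLess (nvar i) n)
      (Seq P (NPut i (NConst 0) (NConst 0) (NAdd (nvar i) (NConst 1))))) (set_nvar i (Suc j) s') t' s''"
    "t' \<le> (N - Suc j) * (T + 13 + ncost n) + (5 + ncost n)" "I N s''" by blast
  have "bval (NLess (nvar i) n) s" using j Suc.prems bound[of j s] by simp
  note exec.WhileTrue[OF this body s''(1)]
  moreover have "1 + bcost (NLess (nvar i) n) + (t + 8) + t' \<le> (N - j) * (T + 13 + ncost n) + (5 + ncost n)"
  proof -
    have "N - j = Suc (N - Suc j)" using j by simp
    then show ?thesis using s'(2) s''(2) by simp
  qed
  ultimately show ?case using s''(3) by blast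
qed

text \<open>The initial assignment and the failing last test fit into one extra round, hence the
  factor N + 1.\<close>

lemma exec_For:
  assumes init: "I 0 (set_nvar i 0 s)"
    and step: "\<And>j s. j < N \<Longrightarrow> I j s \<Longrightarrow> fst s i 0 0 = j \<Longrightarrow>
      \<exists>t s'. exec P s t s' \<and> t \<le> T \<and> fst s' i 0 0 = j \<and> I (Suc j) (set_nvar i (Suc j) s')"
    and bound: "\<And>j s. j \<le> N \<Longrightarrow> I j s \<Longrightarrow> nval n s = N"
  shows "\<exists>t s'. exec (For i n P) s t s' \<and> t \<le> (N + 1) * (T + 13 + ncost n) \<and> I N s'"
proof -
  have 1: "exec (NPut i (NConst 0) (NConst 0) (NConst 0)) s 4 (set_nvar i 0 s)"
    by (rule exec_NPutI) (simp_all add: set_nvar_def)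
  have z: "fst (set_nvar i 0 s) i 0 0 = 0" by (simp add: set_nvar_def put_apply)
  have "\<exists>t s'. exec (While (NLess (nvar i) n)
      (Seq P (NPut i (NConst 0) (NConst 0) (NAdd (nvar i) (NConst 1))))) (set_nvar i 0 s) t s' \<and>
    t \<le> (N - 0) * (T + 13 + ncost n) + (5 + ncost n) \<and> I N s'"
    by (rule exec_While[where I = I and j = 0]) (rule step bound init z le0; assumption)+
  then obtain t s' where 2: "exec (While (NLess (nvar i) n)
      (Seq P (NPut i (NConst 0) (NConst 0) (NAdd (nvar i) (NConst 1))))) (set_nvar i 0 s) t s'"
    "t \<le> N * (T + 13 + ncost n) + (5 + ncost n)" "I N s'"
    unfolding diff_zero by blast
  have "exec (For i n P) s (4 + t) s'" unfolding For_def by (rule exec.Seq[OF 1 2(1)])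
  with 2(2,3) show ?thesis by (intro exI[of _ "4 + t"] exI[of _ s']) auto
qed

text \<open>Only the natural number arrays in \<open>V\<close> and the real arrays in \<open>W\<close> may have changed.\<close>

definition frame :: "name set \<Rightarrow> name set \<Rightarrow> state \<Rightarrow> state \<Rightarrow> bool" where
  "frame V W s s' \<longleftrightarrow> (\<forall>a. a \<notin> V \<longrightarrow> fst s' a = fst s a) \<and> (\<forall>a. a \<notin> W \<longrightarrow> snd s' a = snd s a)"

lemma frame_set_nvar: "frame V W s s' \<Longrightarrow> i \<in> V \<Longrightarrow> frame V W s (set_nvar i n s')"
  by (auto simp: frame_def set_nvar_def put_def)

text \<open>\<open>dest[a][b] := \<Sum>c<n3. e(a, b, c)\<close> for \<open>a < n1\<close> and \<open>b < n2\<close>.\<close>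

definition Fill :: "name \<Rightarrow> nexp \<Rightarrow> nexp \<Rightarrow> nexp \<Rightarrow> rexp \<Rightarrow> com" where
  "Fill dest n1 n2 n3 e =
     For ''a'' n1 (For ''b'' n2
       (Seq (RPut ''acc'' (NConst 0) (NConst 0) (OfNat (NConst 0)))
         (Seq (For ''c'' n3 (RPut ''acc'' (NConst 0) (NConst 0) (RAdd (rvar ''acc'') e)))
           (RPut dest (nvar ''a'') (nvar ''b'') (rvar ''acc'')))))"

text \<open>The hypotheses must hold however \<open>dest\<close> and the accumulator have been
  overwritten, so \<open>e\<close> may not rely on their contents. In-place updates therefore pass
  through a second array.\<close>

lemma exec_Fill:
  assumes dest: "dest \<noteq> ''acc''"
    and bounds: "\<And>s'. frame {''a'', ''b'', ''c''} {''acc'', dest} s s' \<Longrightarrow>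
      nval n1 s' = N1 \<and> nval n2 s' = N2 \<and> nval n3 s' = N3"
    and val: "\<And>s' i j c. frame {''a'', ''b'', ''c''} {''acc'', dest} s s' \<Longrightarrow>
      fst s' ''a'' 0 0 = i \<Longrightarrow> fst s' ''b'' 0 0 = j \<Longrightarrow> fst s' ''c'' 0 0 = c \<Longrightarrow>
      i < N1 \<Longrightarrow> j < N2 \<Longrightarrow> c < N3 \<Longrightarrow> rval e s' = E i j c"
  shows "\<exists>t s'. exec (Fill dest n1 n2 n3 e) s t s' \<and>
    t \<le> (61 + rcost e + ncost n1 + ncost n2 + ncost n3) * ((N1 + 1) * (N2 + 1) * (N3 + 1)) \<and>
    frame {''a'', ''b'', ''c''} {''acc'', dest} s s' \<and>
    (\<forall>i<N1. \<forall>j<N2. snd s' dest i j = (\<Sum>c<N3. E i j c))"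
proof -
  define Fr where "Fr = frame {''a'', ''b'', ''c''} {''acc'', dest} s"
  \<comment> \<open>The cells before (i, j) in row-major order are final.\<close>
  define D where "D i j s' \<longleftrightarrow> (\<forall>p q. q < N2 \<and> (p < i \<or> p = i \<and> q < j) \<longrightarrow>
      snd s' dest p q = (\<Sum>c<N3. E p q c))" for i j and s' :: state
  \<comment> \<open>Every loop adds 13 per round to its body: 20 = 7 + 13 for accumulating, and
    below 28 = 15 + 13 for reset and store.\<close>
  define T3 where "T3 = (N3 + 1) * (20 + rcost e + ncost n3)"
  define T2 where "T2 = (N2 + 1) * (T3 + 28 + ncost n2)"
  have inner: "\<exists>t s''. exec (For ''c'' n3 (RPut ''acc'' (NConst 0) (NConst 0) (RAdd (rvar ''acc'') e))) s' t s'' \<and>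
      t \<le> T3 \<and> (Fr s'' \<and> D i j s'' \<and> fst s'' ''a'' 0 0 = i \<and> fst s'' ''b'' 0 0 = j \<and>
        snd s'' ''acc'' 0 0 = (\<Sum>c<N3. E i j c))"
    if s': "Fr s'" "D i j s'" "fst s' ''a'' 0 0 = i" "fst s' ''b'' 0 0 = j" "snd s' ''acc'' 0 0 = 0"
      and ij: "i < N1" "j < N2" for i j s'
  proof -
    let ?I = "\<lambda>c s''. Fr s'' \<and> D i j s'' \<and> fst s'' ''a'' 0 0 = i \<and> fst s'' ''b'' 0 0 = j \<and>
        snd s'' ''acc'' 0 0 = (\<Sum>c'<c. E i j c')"
    have "\<exists>t s''. exec (For ''c'' n3 (RPut ''acc'' (NConst 0) (NConst 0) (RAdd (rvar ''acc'') e))) s' t s'' \<and>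
      t \<le> (N3 + 1) * (7 + rcost e + 13 + ncost n3) \<and> ?I N3 s''"
    proof (rule exec_For[where I = ?I])
      show "?I 0 (set_nvar ''c'' 0 s')"
        using s' by (auto simp: Fr_def frame_set_nvar D_def) (auto simp: set_nvar_def put_apply)
    next
      fix c s1 assume c: "c < N3" and I: "?I c s1" and cs: "fst s1 ''c'' 0 0 = c"
      let ?s2 = "(fst s1, put (snd s1) ''acc'' 0 0 (snd s1 ''acc'' 0 0 + rval e s1))"
      have e: "rval e s1 = E i j c" using val[of s1] I c cs ij by (simp add: Fr_def)
      have "exec (RPut ''acc'' (NConst 0) (NConst 0) (RAdd (rvar ''acc'') e)) s1 (7 + rcost e) ?s2"
        by (rule exec_RPutI) simp_all
      moreover have "fst ?s2 ''c'' 0 0 = c" using cs by simp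
      moreover have "?I (Suc c) (set_nvar ''c'' (Suc c) ?s2)"
      proof -
        have "Fr ?s2" using I by (auto simp: Fr_def frame_def put_def)
        moreover have "D i j (set_nvar ''c'' (Suc c) ?s2)"
          using I dest by (auto simp: D_def set_nvar_def put_apply)
        ultimately show ?thesis using I e
          by (auto simp: Fr_def frame_set_nvar) (auto simp: set_nvar_def put_apply)
      qed
      ultimately show "\<exists>t s'. exec (RPut ''acc'' (NConst 0) (NConst 0) (RAdd (rvar ''acc'') e)) s1 t s' \<and>
          t \<le> 7 + rcost e \<and> fst s' ''c'' 0 0 = c \<and> ?I (Suc c) (set_nvar ''c'' (Suc c) s')"
        by blast
    next
      fix c s1 assume "?I c s1"
      then show "nval n3 s1 = N3" using bounds[of s1] by (simp add: Fr_def)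
    qed
    moreover have "(N3 + 1) * (7 + rcost e + 13 + ncost n3) = T3" by (simp add: T3_def algebra_simps)
    ultimately show ?thesis by simp
  qed
  define B where "B = Seq (RPut ''acc'' (NConst 0) (NConst 0) (OfNat (NConst 0)))
         (Seq (For ''c'' n3 (RPut ''acc'' (NConst 0) (NConst 0) (RAdd (rvar ''acc'') e)))
           (RPut dest (nvar ''a'') (nvar ''b'') (rvar ''acc'')))"
  have body: "\<exists>t s''. exec B s' t s'' \<and> t \<le> T3 + 15 \<and> Fr s'' \<and> D i (Suc j) s'' \<and>
      fst s'' ''a'' 0 0 = i \<and> fst s'' ''b'' 0 0 = j"
    if s': "Fr s'" "D i j s'" "fst s' ''a'' 0 0 = i" "fst s' ''b'' 0 0 = j"
      and ij: "i < N1" "j < N2" for i j s'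
  proof -
    let ?s1 = "(fst s', put (snd s') ''acc'' 0 0 0)"
    have 1: "exec (RPut ''acc'' (NConst 0) (NConst 0) (OfNat (NConst 0))) s' 5 ?s1"
      by (rule exec_RPutI) simp_all
    have "Fr ?s1" using s' by (auto simp: Fr_def frame_def put_def)
    moreover have "D i j ?s1" using s' dest by (auto simp: D_def put_apply)
    ultimately obtain t s2 where
      2: "exec (For ''c'' n3 (RPut ''acc'' (NConst 0) (NConst 0) (RAdd (rvar ''acc'') e))) ?s1 t s2" "t \<le> T3"
      and s2: "Fr s2" "D i j s2" "fst s2 ''a'' 0 0 = i" "fst s2 ''b'' 0 0 = j"
        "snd s2 ''acc'' 0 0 = (\<Sum>c<N3. E i j c)"
      using inner[of ?s1 i j] s' ij by (auto simp: put_apply)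
    let ?s3 = "(fst s2, put (snd s2) dest i j (\<Sum>c<N3. E i j c))"
    have 3: "exec (RPut dest (nvar ''a'') (nvar ''b'') (rvar ''acc'')) s2 10 ?s3"
      using s2 by (intro exec_RPutI) simp_all
    have "exec B s' (5 + (t + 10)) ?s3" unfolding B_def by (rule exec.Seq[OF 1 exec.Seq[OF 2(1) 3]])
    moreover have "Fr ?s3" using s2 by (auto simp: Fr_def frame_def put_def)
    moreover have "D i (Suc j) ?s3" using s2 by (auto simp: D_def put_apply less_Suc_eq)
    ultimately show ?thesis using 2(2) s2 by (intro exI[of _ "5 + (t + 10)"] exI[of _ ?s3]) auto
  qed
  have row: "\<exists>t s''. exec (For ''b'' n2 B) s' t s'' \<and> t \<le> T2 \<and> (Fr s'' \<and> D (Suc i) 0 s'' \<and> fst s'' ''a'' 0 0 = i)"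
    if s': "Fr s'" "D i 0 s'" "fst s' ''a'' 0 0 = i" and i: "i < N1" for i s'
  proof -
    let ?I = "\<lambda>j s''. Fr s'' \<and> D i j s'' \<and> fst s'' ''a'' 0 0 = i"
    have "\<exists>t s''. exec (For ''b'' n2 B) s' t s'' \<and> t \<le> (N2 + 1) * (T3 + 15 + 13 + ncost n2) \<and> ?I N2 s''"
    proof (rule exec_For[where I = ?I])
      show "?I 0 (set_nvar ''b'' 0 s')"
        using s' by (auto simp: Fr_def frame_set_nvar D_def) (auto simp: set_nvar_def put_apply)
    next
      fix j s1 assume "j < N2" "?I j s1" "fst s1 ''b'' 0 0 = j"
      then obtain t s2 where "exec B s1 t s2" "t \<le> T3 + 15" "Fr s2" "D i (Suc j) s2"
        "fst s2 ''a'' 0 0 = i" "fst s2 ''b'' 0 0 = j" using body[of s1 i j] i by blast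
      then show "\<exists>t s'. exec B s1 t s' \<and> t \<le> T3 + 15 \<and> fst s' ''b'' 0 0 = j \<and> ?I (Suc j) (set_nvar ''b'' (Suc j) s')"
        by (intro exI[of _ t] exI[of _ s2]) (auto simp: Fr_def frame_set_nvar D_def, auto simp: set_nvar_def put_apply)
    next
      fix j s1 assume "?I j s1"
      then show "nval n2 s1 = N2" using bounds[of s1] by (simp add: Fr_def)
    qed
    then obtain t s'' where "exec (For ''b'' n2 B) s' t s''" "t \<le> (N2 + 1) * (T3 + 15 + 13 + ncost n2)" "?I N2 s''"
      by blast
    moreover from this have "D (Suc i) 0 s''" by (auto simp: D_def less_Suc_eq)
    moreover have "(N2 + 1) * (T3 + 15 + 13 + ncost n2) = T2" by (simp add: T2_def algebra_simps)
    ultimately show ?thesis by metis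
  qed
  let ?I = "\<lambda>i s'. Fr s' \<and> D i 0 s'"
  have "\<exists>t s'. exec (For ''a'' n1 (For ''b'' n2 B)) s t s' \<and> t \<le> (N1 + 1) * (T2 + 13 + ncost n1) \<and> ?I N1 s'"
  proof (rule exec_For[where I = ?I])
    show "?I 0 (set_nvar ''a'' 0 s)"
      by (auto simp: Fr_def D_def intro!: frame_set_nvar) (simp add: frame_def)
  next
    fix i s1 assume "i < N1" "?I i s1" "fst s1 ''a'' 0 0 = i"
    then obtain t s2 where "exec (For ''b'' n2 B) s1 t s2" "t \<le> T2" "Fr s2" "D (Suc i) 0 s2"
      "fst s2 ''a'' 0 0 = i" using row[of s1 i] by blast
    then show "\<exists>t s'. exec (For ''b'' n2 B) s1 t s' \<and> t \<le> T2 \<and> fst s' ''a'' 0 0 = i \<and> ?I (Suc i) (set_nvar ''a'' (Suc i) s')"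
      by (intro exI[of _ t] exI[of _ s2]) (auto simp: Fr_def frame_set_nvar D_def, auto simp: set_nvar_def)
  next
    fix i s1 assume "?I i s1"
    then show "nval n1 s1 = N1" using bounds[of s1] by (simp add: Fr_def)
  qed
  then obtain t s' where s': "exec (Fill dest n1 n2 n3 e) s t s'" "t \<le> (N1 + 1) * (T2 + 13 + ncost n1)" "?I N1 s'"
    unfolding Fill_def B_def by blast
  have "(N1 + 1) * (T2 + 13 + ncost n1) \<le>
      (61 + rcost e + ncost n1 + ncost n2 + ncost n3) * ((N1 + 1) * (N2 + 1) * (N3 + 1))"
  proof -
    have "T3 + 28 + ncost n2 \<le> (N3 + 1) * (48 + rcost e + ncost n2 + ncost n3)"
      by (simp add: T3_def algebra_simps)
    then have "T2 \<le> (N2 + 1) * ((N3 + 1) * (48 + rcost e + ncost n2 + ncost n3))"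
      unfolding T2_def by (rule mult_le_mono2)
    moreover have "13 + ncost n1 \<le> (N2 + 1) * (N3 + 1) * (13 + ncost n1)" by simp
    ultimately have "T2 + 13 + ncost n1 \<le> (N2 + 1) * (N3 + 1) * (61 + rcost e + ncost n1 + ncost n2 + ncost n3)"
      by (simp add: algebra_simps)
    then have "(N1 + 1) * (T2 + 13 + ncost n1) \<le>
        (N1 + 1) * ((N2 + 1) * (N3 + 1) * (61 + rcost e + ncost n1 + ncost n2 + ncost n3))"
      by (rule mult_le_mono2)
    then show ?thesis by (simp only: mult_ac)
  qed
  with s' show ?thesis
    by (intro exI[of _ t] exI[of _ s']) (auto simp: Fr_def D_def)
qed

text \<open>Elimination form with the sum rewritten to its intended value and the constant rounded
  up; later uses take K = 100.\<close>

lemma exec_FillE: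
  assumes "dest \<noteq> ''acc''"
    and "\<And>s'. frame {''a'', ''b'', ''c''} {''acc'', dest} s s' \<Longrightarrow>
      nval n1 s' = N1 \<and> nval n2 s' = N2 \<and> nval n3 s' = N3"
    and "\<And>s' i j c. frame {''a'', ''b'', ''c''} {''acc'', dest} s s' \<Longrightarrow>
      fst s' ''a'' 0 0 = i \<Longrightarrow> fst s' ''b'' 0 0 = j \<Longrightarrow> fst s' ''c'' 0 0 = c \<Longrightarrow>
      i < N1 \<Longrightarrow> j < N2 \<Longrightarrow> c < N3 \<Longrightarrow> rval e s' = E i j c"
    and K: "61 + rcost e + ncost n1 + ncost n2 + ncost n3 \<le> K"
    and F: "\<And>i j. i < N1 \<Longrightarrow> j < N2 \<Longrightarrow> (\<Sum>c<N3. E i j c) = F i j"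
  obtains t s' where "exec (Fill dest n1 n2 n3 e) s t s'" "t \<le> K * ((N1 + 1) * (N2 + 1) * (N3 + 1))"
    "frame {''a'', ''b'', ''c''} {''acc'', dest} s s'" "\<forall>i<N1. \<forall>j<N2. snd s' dest i j = F i j"
proof -
  have "\<exists>t s'. exec (Fill dest n1 n2 n3 e) s t s' \<and>
    t \<le> (61 + rcost e + ncost n1 + ncost n2 + ncost n3) * ((N1 + 1) * (N2 + 1) * (N3 + 1)) \<and>
    frame {''a'', ''b'', ''c''} {''acc'', dest} s s' \<and>
    (\<forall>i<N1. \<forall>j<N2. snd s' dest i j = (\<Sum>c<N3. E i j c))"
    using assms(1-3) by (rule exec_Fill)
  then obtain t s' where s': "exec (Fill dest n1 n2 n3 e) s t s'"
    "t \<le> (61 + rcost e + ncost n1 + ncost n2 + ncost n3) * ((N1 + 1) * (N2 + 1) * (N3 + 1))"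
    "frame {''a'', ''b'', ''c''} {''acc'', dest} s s'"
    "\<forall>i<N1. \<forall>j<N2. snd s' dest i j = (\<Sum>c<N3. E i j c)" by blast
  show thesis
  proof (rule that[OF s'(1) _ s'(3)])
    show "t \<le> K * ((N1 + 1) * (N2 + 1) * (N3 + 1))"
      using s'(2) mult_le_mono1[OF K] by (rule order_trans)
  qed (use s'(4) F in simp)
qed

section \<open>The rounding program\<close>

abbreviation Dim :: nexp where "Dim \<equiv> nvar ''d''"

abbreviation At :: "name \<Rightarrow> name \<Rightarrow> name \<Rightarrow> rexp" where
  "At A i j \<equiv> RGet A (nvar i) (nvar j)"

text \<open>Expressions have no conditional, but with truncated subtraction 1 - (a - b) - (b - a) is
  1 exactly if a = b.\<close>

definition Kronecker :: rexp where
  "Kronecker = OfNat (NSub (NSub (NConst 1) (NSub (nvar ''a'') (nvar ''b''))) (NSub (nvar ''b'') (nvar ''a'')))"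

lemma rval_Kronecker [simp]:
  "rval Kronecker s = (if fst s ''a'' 0 0 = fst s ''b'' 0 0 then 1 else 0)"
  by (auto simp: Kronecker_def)

lemma rcost_Kronecker [simp]: "rcost Kronecker = 18"
  by (simp add: Kronecker_def)

text \<open>After \<open>j\<close> steps \<open>N\<close> is the coefficient of \<open>z\<^bsup>d-1-j\<^esup>\<close> in \<open>adj (z I + B)\<close>, while \<open>H\<close> accumulates the
  coefficients with falling factorial weights by a Horner scheme.\<close>

definition Faddeev_step :: com where
  "Faddeev_step =
    Seq (Fill ''P'' Dim Dim Dim (RMul (At ''B'' ''a'' ''c'') (At ''N'' ''c'' ''b'')))
   (Seq (Fill ''q'' (NConst 1) (NConst 1) Dim
          (RDiv (At ''P'' ''c'' ''c'') (OfNat (NAdd (nvar ''j'') (NConst 1)))))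
   (Seq (Fill ''N'' Dim Dim (NConst 1) (RSub (RMul (rvar ''q'') Kronecker) (At ''P'' ''a'' ''b'')))
   (Seq (Fill ''P'' Dim Dim (NConst 1) (RAdd (At ''N'' ''a'' ''b'')
          (RMul (RSub (OfNat (nvar ''r'')) (OfNat (NSub (NSub Dim (NConst 2)) (nvar ''j''))))
            (At ''H'' ''a'' ''b''))))
        (Fill ''H'' Dim Dim (NConst 1) (At ''P'' ''a'' ''b'')))))"

text \<open>Both arrays start at the identity, the coefficient of z^(d-1); the d - 1 steps descend
  to z^0.\<close>

definition Faddeev :: com where
  "Faddeev =
    Seq (Fill ''N'' Dim Dim (NConst 1) Kronecker)
   (Seq (Fill ''H'' Dim Dim (NConst 1) Kronecker)
        (For ''j'' (NSub Dim (NConst 1)) Faddeev_step))"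

text \<open>After \<open>N\<close> has consumed the product in \<open>P\<close>, this array is
  reused as scratch space, because a fill must not read its own destination
  \<open>H\<close>.\<close>

lemma exec_Faddeev_step:
  assumes d: "fst s ''d'' 0 0 = d" "d \<ge> 1" and j: "fst s ''j'' 0 0 = j" and r: "fst s ''r'' 0 0 = r"
    and P: "\<And>a b. P a b = (\<Sum>c<d. snd s ''B'' a c * snd s ''N'' c b)"
    and q: "q = (\<Sum>c<d. P c c / real (j + 1))"
    and N: "\<And>a b. N a b = q * (if a = b then 1 else 0) - P a b"
    and H: "\<And>a b. H a b = N a b + (real r - real (d - 2 - j)) * snd s ''H'' a b"
  obtains t s' where "exec Faddeev_step s t s'" "t \<le> 500 * (d + 1) ^ 3"
    "frame {''a'', ''b'', ''c''} {''acc'', ''P'', ''q'', ''N'', ''H''} s s'"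
    "\<forall>a<d. \<forall>b<d. snd s' ''N'' a b = N a b" "\<forall>a<d. \<forall>b<d. snd s' ''H'' a b = H a b"
proof -
  obtain t1 s1 where 1: "exec (Fill ''P'' Dim Dim Dim (RMul (At ''B'' ''a'' ''c'') (At ''N'' ''c'' ''b''))) s t1 s1"
    "t1 \<le> 100 * ((d + 1) * (d + 1) * (d + 1))"
    "frame {''a'', ''b'', ''c''} {''acc'', ''P''} s s1" "\<forall>a<d. \<forall>b<d. snd s1 ''P'' a b = P a b"
    by (rule exec_FillE[where E = "\<lambda>a b c. snd s ''B'' a c * snd s ''N'' c b", rotated -1],
        rule that, assumption+) (simp_all add: frame_def d j r P)
  obtain t2 s2 where 2: "exec (Fill ''q'' (NConst 1) (NConst 1) Dim
          (RDiv (At ''P'' ''c'' ''c'') (OfNat (NAdd (nvar ''j'') (NConst 1))))) s1 t2 s2"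
    "t2 \<le> 100 * ((1 + 1) * (1 + 1) * (d + 1))"
    "frame {''a'', ''b'', ''c''} {''acc'', ''q''} s1 s2" "\<forall>a<1. \<forall>b<1. snd s2 ''q'' a b = q"
    by (rule exec_FillE[where E = "\<lambda>a b c. P c c / real (j + 1)", rotated -1],
        rule that, assumption+) (use 1(3,4) in \<open>simp_all add: frame_def d j r q\<close>)
  obtain t3 s3 where 3: "exec (Fill ''N'' Dim Dim (NConst 1) (RSub (RMul (rvar ''q'') Kronecker) (At ''P'' ''a'' ''b''))) s2 t3 s3"
    "t3 \<le> 100 * ((d + 1) * (d + 1) * (1 + 1))"
    "frame {''a'', ''b'', ''c''} {''acc'', ''N''} s2 s3" "\<forall>a<d. \<forall>b<d. snd s3 ''N'' a b = N a b"
    by (rule exec_FillE[where E = "\<lambda>a b c. N a b", rotated -1],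
        rule that, assumption+) (use 1(3,4) 2(3,4) in \<open>simp_all add: frame_def d j r N\<close>)
  obtain t4 s4 where 4: "exec (Fill ''P'' Dim Dim (NConst 1) (RAdd (At ''N'' ''a'' ''b'')
          (RMul (RSub (OfNat (nvar ''r'')) (OfNat (NSub (NSub Dim (NConst 2)) (nvar ''j''))))
            (At ''H'' ''a'' ''b'')))) s3 t4 s4"
    "t4 \<le> 100 * ((d + 1) * (d + 1) * (1 + 1))"
    "frame {''a'', ''b'', ''c''} {''acc'', ''P''} s3 s4" "\<forall>a<d. \<forall>b<d. snd s4 ''P'' a b = H a b"
    by (rule exec_FillE[where E = "\<lambda>a b c. H a b", rotated -1],
        rule that, assumption+) (use 1(3) 2(3) 3(3,4) in \<open>simp_all add: frame_def d j r H\<close>)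
  obtain t5 s5 where 5: "exec (Fill ''H'' Dim Dim (NConst 1) (At ''P'' ''a'' ''b'')) s4 t5 s5"
    "t5 \<le> 100 * ((d + 1) * (d + 1) * (1 + 1))"
    "frame {''a'', ''b'', ''c''} {''acc'', ''H''} s4 s5" "\<forall>a<d. \<forall>b<d. snd s5 ''H'' a b = H a b"
    by (rule exec_FillE[where E = "\<lambda>a b c. H a b", rotated -1],
        rule that, assumption+) (use 1(3) 2(3) 3(3) 4(3,4) in \<open>simp_all add: frame_def d j r\<close>)
  show thesis
  proof (rule that)
    show "exec Faddeev_step s (t1 + (t2 + (t3 + (t4 + t5)))) s5"
      unfolding Faddeev_step_def
      by (rule exec.Seq[OF 1(1) exec.Seq[OF 2(1) exec.Seq[OF 3(1) exec.Seq[OF 4(1) 5(1)]]]])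
    show "t1 + (t2 + (t3 + (t4 + t5))) \<le> 500 * (d + 1) ^ 3"
    proof -
      have *: "(d + 1) * (d + 1) * (d + 1) = (d + 1) ^ 3" by (simp add: power3_eq_cube)
      have "(1 + 1) * (1 + 1) * (d + 1) \<le> (d + 1) ^ 3"
        unfolding *[symmetric] using d(2) by (intro mult_le_mono) auto
      moreover have "(d + 1) * (d + 1) * (1 + 1) \<le> (d + 1) ^ 3"
        unfolding *[symmetric] using d(2) by (intro mult_le_mono) auto
      ultimately show ?thesis
        using 1(2) 2(2) 3(2) 4(2) 5(2) unfolding * by linarith
    qed
    show "frame {''a'', ''b'', ''c''} {''acc'', ''P'', ''q'', ''N'', ''H''} s s5"
      using 1(3) 2(3) 3(3) 4(3) 5(3) by (simp add: frame_def)
    show "\<forall>a<d. \<forall>b<d. snd s5 ''N'' a b = N a b"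
      using 3(4) 4(3) 5(3) by (simp add: frame_def)
  qed (rule 5(4))
qed

lemma exec_Faddeev:
  assumes d: "fst s ''d'' 0 0 = d" "d \<ge> 1" and r: "fst s ''r'' 0 0 = r"
    and B: "B = mat d d (\<lambda>(a, b). snd s ''B'' a b)"
  obtains t s' where "exec Faddeev s t s'" "t \<le> 1000 * (d + 1) ^ 4"
    "frame {''a'', ''b'', ''c'', ''j''} {''acc'', ''P'', ''q'', ''N'', ''H''} s s'"
    "\<forall>a<d. \<forall>b<d. snd s' ''H'' a b = gain_mat d r B $$ (a, b)"
proof -
  have Bc: "B \<in> carrier_mat d d" by (simp add: B)
  define V where "V = {''a'', ''b'', ''c'', ''j''}"
  define W where "W = {''acc'', ''P'', ''q'', ''N'', ''H''}"
  obtain t1 s1 where 1: "exec (Fill ''N'' Dim Dim (NConst 1) Kronecker) s t1 s1"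
    "t1 \<le> 100 * ((d + 1) * (d + 1) * (1 + 1))"
    "frame {''a'', ''b'', ''c''} {''acc'', ''N''} s s1"
    "\<forall>a<d. \<forall>b<d. snd s1 ''N'' a b = (if a = b then 1 else 0)"
    by (rule exec_FillE[where E = "\<lambda>a b c. if a = b then 1 else 0", rotated -1],
        rule that, assumption+) (simp_all add: frame_def d)
  obtain t2 s2 where 2: "exec (Fill ''H'' Dim Dim (NConst 1) Kronecker) s1 t2 s2"
    "t2 \<le> 100 * ((d + 1) * (d + 1) * (1 + 1))"
    "frame {''a'', ''b'', ''c''} {''acc'', ''H''} s1 s2"
    "\<forall>a<d. \<forall>b<d. snd s2 ''H'' a b = (if a = b then 1 else 0)"
    by (rule exec_FillE[where E = "\<lambda>a b c. if a = b then 1 else 0", rotated -1],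
        rule that, assumption+) (use 1(3) in \<open>simp_all add: frame_def d\<close>)
  \<comment> \<open>The Horner invariant carries the factor \<open>falling r (d - 1 - j)\<close>,
    which may be 0 and then leaves \<open>H\<close> unconstrained. At the end the factor is
    \<open>falling r 0\<close> = 1 and \<open>H\<close> is the full sum.\<close>
  define I where "I j s' \<longleftrightarrow> frame V W s s' \<and>
     (\<forall>a<d. \<forall>b<d. snd s' ''N'' a b = adj_coeff B (d - 1 - j) $$ (a, b)) \<and>
     (\<forall>a<d. \<forall>b<d. falling r (d - 1 - j) * snd s' ''H'' a b =
        (\<Sum>i\<in>{d - 1 - j..<d}. falling r i * adj_coeff B i $$ (a, b)))" for j s'
  have I_set: "I j (set_nvar ''j'' n s') \<longleftrightarrow> I j s'" if "frame V W s s'" for j n s'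
    using that frame_set_nvar[OF that, of "''j''" n] by (simp add: I_def V_def) (simp add: set_nvar_def)
  have "\<exists>t s'. exec (For ''j'' (NSub Dim (NConst 1)) Faddeev_step) s2 t s' \<and>
      t \<le> (d - 1 + 1) * (500 * (d + 1) ^ 3 + 13 + ncost (NSub Dim (NConst 1))) \<and> I (d - 1) s'"
  proof (rule exec_For[where I = I])
    have fr: "frame V W s s2" using 1(3) 2(3) by (simp add: frame_def V_def W_def)
    have "{d - 1 - 0..<d} = {d - 1}" using d(2) by auto
    then have "I 0 s2"
      using fr 1(4) 2(3,4) d(2) adj_coeff_top[OF Bc]
      by (simp add: I_def) (simp add: frame_def)
    then show "I 0 (set_nvar ''j'' 0 s2)" using I_set[OF fr] by simp
  next
    fix j s1 assume j: "j < d - 1" and I: "I j s1" and js: "fst s1 ''j'' 0 0 = j"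
    from I have fr: "frame V W s s1" by (simp add: I_def)
    have I1: "snd s1 ''N'' a b = adj_coeff B (d - 1 - j) $$ (a, b)"
      and I2: "falling r (d - 1 - j) * snd s1 ''H'' a b =
        (\<Sum>i\<in>{d - 1 - j..<d}. falling r i * adj_coeff B i $$ (a, b))" if "a < d" "b < d" for a b
      using I that by (auto simp: I_def)
    \<comment> \<open>The exponent reached by this step; \<open>d - Suc e\<close> is the divisor in
      the trace formula.\<close>
    define e where "e = d - 2 - j"
    have e: "d - 1 - j = Suc e" "d - 1 - Suc j = e" "Suc e < d" "d - Suc e = j + 1"
      using j by (auto simp: e_def)
    define P where "P a b = (\<Sum>c<d. snd s1 ''B'' a c * snd s1 ''N'' c b)" for a b
    define q where "q = (\<Sum>c<d. P c c / real (j + 1))"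
    define N where "N a b = q * (if a = b then 1 else 0) - P a b" for a b :: nat
    define H where "H a b = N a b + (real r - real (d - 2 - j)) * snd s1 ''H'' a b" for a b
    have "fst s1 ''d'' 0 0 = d" "fst s1 ''r'' 0 0 = r"
      using fr d r by (simp_all add: frame_def V_def)
    from exec_Faddeev_step[OF this(1) d(2) js this(2) P_def q_def N_def H_def]
    obtain t s2 where s2: "exec Faddeev_step s1 t s2" "t \<le> 500 * (d + 1) ^ 3"
      "frame {''a'', ''b'', ''c''} {''acc'', ''P'', ''q'', ''N'', ''H''} s1 s2"
      "\<forall>a<d. \<forall>b<d. snd s2 ''N'' a b = N a b" "\<forall>a<d. \<forall>b<d. snd s2 ''H'' a b = H a b" .
    have fr2: "frame V W s s2" using fr s2(3) by (simp add: frame_def V_def W_def)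
    have P: "P a b = (B * adj_coeff B (Suc e)) $$ (a, b)" if "a < d" "b < d" for a b
    proof -
      have "snd s1 ''B'' = snd s ''B''" using fr by (simp add: frame_def W_def)
      then have "P a b = (\<Sum>c<d. B $$ (a, c) * adj_coeff B (Suc e) $$ (c, b))"
        unfolding P_def using that I1[unfolded e(1)] by (intro sum.cong) (auto simp: B)
      then show ?thesis
        using that Bc by (simp add: scalar_prod_def atLeast0LessThan)
    qed
    have q: "q = coeff (shifted_det B) (Suc e)"
      unfolding q_def shifted_det_coeff_trace[OF Bc e(3)] e(4) sum_divide_distrib
      by (intro sum.cong) (auto simp: P)
    have N: "N a b = adj_coeff B e $$ (a, b)" if "a < d" "b < d" for a b
      using that Bc by (subst adj_coeff_recurrence[OF Bc]) (simp add: N_def q P)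
    have H: "falling r e * H a b = (\<Sum>i\<in>{e..<d}. falling r i * adj_coeff B i $$ (a, b))"
      if "a < d" "b < d" for a b
    proof -
      \<comment> \<open>The factor r - e of the Horner step extends \<open>falling r e\<close> to
        \<open>falling r (Suc e)\<close>, so the old invariant applies.\<close>
      have "falling r e * H a b = falling r e * N a b + falling r (Suc e) * snd s1 ''H'' a b"
        unfolding H_def e_def[symmetric] falling_Suc by (simp add: algebra_simps)
      also have "\<dots> = falling r e * adj_coeff B e $$ (a, b) +
          (\<Sum>i\<in>{Suc e..<d}. falling r i * adj_coeff B i $$ (a, b))"
        using I2[OF that] N[OF that] e(1) by simp
      also have "\<dots> = (\<Sum>i\<in>{e..<d}. falling r i * adj_coeff B i $$ (a, b))"
        using e(3) by (simp add: sum.atLeast_Suc_lessThan)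
      finally show ?thesis .
    qed
    have "I (Suc j) s2" using fr2 s2(4,5) N H unfolding I_def e(2) by simp
    then have "I (Suc j) (set_nvar ''j'' (Suc j) s2)" using I_set[OF fr2] by simp
    moreover have "fst s2 ''j'' 0 0 = j" using js s2(3) by (simp add: frame_def)
    ultimately show "\<exists>t s'. exec Faddeev_step s1 t s' \<and> t \<le> 500 * (d + 1) ^ 3 \<and> fst s' ''j'' 0 0 = j \<and>
        I (Suc j) (set_nvar ''j'' (Suc j) s')" using s2(1,2) by blast
  next
    fix j s1 assume "I j s1"
    then show "nval (NSub Dim (NConst 1)) s1 = d - 1" using d by (simp add: I_def frame_def V_def)
  qed
  then obtain t3 s3 where 3: "exec (For ''j'' (NSub Dim (NConst 1)) Faddeev_step) s2 t3 s3"
    "t3 \<le> (d - 1 + 1) * (500 * (d + 1) ^ 3 + 13 + ncost (NSub Dim (NConst 1)))" "I (d - 1) s3" by blast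
  show thesis
  proof (rule that)
    show "exec Faddeev s (t1 + (t2 + t3)) s3"
      unfolding Faddeev_def by (rule exec.Seq[OF 1(1) exec.Seq[OF 2(1) 3(1)]])
    show "t1 + (t2 + t3) \<le> 1000 * (d + 1) ^ 4"
    proof -
      have pos: "(d + 1) ^ 3 \<ge> 1" by simp
      have "(d + 1) * (d + 1) * (1 + 1) \<le> (d + 1) ^ 3"
        unfolding power3_eq_cube using d(2) by (intro mult_le_mono) auto
      then have "t1 + t2 \<le> 200 * (d + 1) ^ 3" using 1(2) 2(2) by linarith
      moreover have "t3 \<le> (d + 1) * (600 * (d + 1) ^ 3)"
      proof (rule order_trans[OF 3(2)], rule mult_le_mono)
        show "500 * (d + 1) ^ 3 + 13 + ncost (NSub Dim (NConst 1)) \<le> 600 * (d + 1) ^ 3"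
        proof -
          have "ncost (NSub Dim (NConst 1)) = 5" by simp
          with pos show ?thesis by linarith
        qed
      qed (use d in simp)
      moreover have "200 * (d + 1) ^ 3 \<le> (d + 1) * (200 * (d + 1) ^ 3)" by simp
      moreover have "(d + 1) ^ 4 = (d + 1) * (d + 1) ^ 3" by (simp flip: power_Suc)
      ultimately show ?thesis by linarith
    qed
    show "frame {''a'', ''b'', ''c'', ''j''} {''acc'', ''P'', ''q'', ''N'', ''H''} s s3"
      using 3(3) by (simp add: I_def V_def W_def)
    show "\<forall>a<d. \<forall>b<d. snd s3 ''H'' a b = gain_mat d r B $$ (a, b)"
      using 3(3) by (simp add: I_def gain_mat_def atLeast0LessThan)
  qed
qed

section \<open>One greedy selection\<close>

definition Argmax :: com where
  "Argmax = Seq (NPut ''best'' (NConst 0) (NConst 0) (NConst 0))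
    (For ''i'' (nvar ''m'')
      (Cond (RLess (RGet ''val'' (nvar ''best'') (NConst 0)) (RGet ''val'' (nvar ''i'') (NConst 0)))
        (NPut ''best'' (NConst 0) (NConst 0) (nvar ''i'')) Skip))"

lemma exec_Argmax:
  assumes m: "fst s ''m'' 0 0 = m" "m \<ge> 1"
  obtains t s' b where "exec Argmax s t s'" "t \<le> 40 * (m + 1)"
    "frame {''best'', ''i''} {} s s'" "fst s' ''best'' 0 0 = b" "b < m"
    "\<forall>i<m. snd s ''val'' i 0 \<le> snd s ''val'' b 0"
proof -
  let ?C = "Cond (RLess (RGet ''val'' (nvar ''best'') (NConst 0)) (RGet ''val'' (nvar ''i'') (NConst 0)))
        (NPut ''best'' (NConst 0) (NConst 0) (nvar ''i'')) Skip"
  let ?b = "RLess (RGet ''val'' (nvar ''best'') (NConst 0)) (RGet ''val'' (nvar ''i'') (NConst 0))"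
  define I where "I n s' \<longleftrightarrow> frame {''best'', ''i''} {} s s' \<and> fst s' ''best'' 0 0 < m \<and>
    (\<forall>i<n. snd s ''val'' i 0 \<le> snd s ''val'' (fst s' ''best'' 0 0) 0)" for n s'
  have I_set: "I n (set_nvar ''i'' l s')" if "I n s'" for n l s'
    using that frame_set_nvar[of "{''best'', ''i''}" "{}" s s' "''i''" l]
    by (simp add: I_def) (simp add: set_nvar_def put_apply)
  let ?s1 = "set_nvar ''best'' 0 s"
  have 1: "exec (NPut ''best'' (NConst 0) (NConst 0) (NConst 0)) s 4 ?s1"
    by (rule exec_NPutI) (simp_all add: set_nvar_def)
  have "\<exists>t s'. exec (For ''i'' (nvar ''m'') ?C) ?s1 t s' \<and> t \<le> (m + 1) * (18 + 13 + ncost (nvar ''m'')) \<and> I m s'"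
  proof (rule exec_For[where I = I])
    have "I 0 ?s1"
      using m(2) by (simp add: I_def frame_def) (simp add: set_nvar_def put_def)
    then show "I 0 (set_nvar ''i'' 0 ?s1)" by (rule I_set)
  next
    fix n s2 assume n: "n < m" and I: "I n s2" and ns: "fst s2 ''i'' 0 0 = n"
    have sv: "snd s2 = snd s" using I by (auto simp: I_def frame_def)
    have le: "snd s ''val'' i 0 \<le> snd s ''val'' (fst s2 ''best'' 0 0) 0" if "i < n" for i
      using I that by (simp add: I_def)
    show "\<exists>t s'. exec ?C s2 t s' \<and> t \<le> 18 \<and> fst s' ''i'' 0 0 = n \<and> I (Suc n) (set_nvar ''i'' (Suc n) s')"
    proof (cases "snd s ''val'' (fst s2 ''best'' 0 0) 0 < snd s ''val'' n 0")
      case True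
      let ?s3 = "set_nvar ''best'' n s2"
      have "exec (NPut ''best'' (NConst 0) (NConst 0) (nvar ''i'')) s2 6 ?s3"
        using ns by (intro exec_NPutI) (simp_all add: set_nvar_def)
      then have "exec ?C s2 (1 + bcost ?b + 6) ?s3"
        using True ns sv by (intro exec.CondTrue) simp_all
      moreover have "frame {''best'', ''i''} {} s ?s3"
        using I by (intro frame_set_nvar) (simp_all add: I_def)
      then have "I (Suc n) ?s3"
        using n True le by (simp add: I_def) (force simp: set_nvar_def put_apply less_Suc_eq)
      then have "I (Suc n) (set_nvar ''i'' (Suc n) ?s3)" by (rule I_set)
      moreover have "fst ?s3 ''i'' 0 0 = n" using ns by (simp add: set_nvar_def put_apply)
      moreover have "1 + bcost ?b + 6 \<le> 18" by simp
      ultimately show ?thesis by blast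
    next
      case False
      have "exec ?C s2 (1 + bcost ?b + 1) s2"
        using False ns sv by (intro exec.CondFalse exec.Skip) simp_all
      moreover have "I (Suc n) s2" using I False by (auto simp: I_def less_Suc_eq)
      then have "I (Suc n) (set_nvar ''i'' (Suc n) s2)" by (rule I_set)
      moreover have "1 + bcost ?b + 1 \<le> 18" by simp
      ultimately show ?thesis using ns by blast
    qed
  next
    fix n s2 assume "I n s2"
    then show "nval (nvar ''m'') s2 = m" using m by (simp add: I_def frame_def)
  qed
  then obtain t s' where 2: "exec (For ''i'' (nvar ''m'') ?C) ?s1 t s'"
    "t \<le> (m + 1) * (18 + 13 + ncost (nvar ''m''))" "I m s'" by blast
  show thesis
  proof (rule that[of _ _ "fst s' ''best'' 0 0"])
    show "exec Argmax s (4 + t) s'" unfolding Argmax_def by (rule exec.Seq[OF 1 2(1)])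
    show "4 + t \<le> 40 * (m + 1)" using 2(2) m(2) by simp
  qed (use 2(3) in \<open>simp_all add: I_def\<close>)
qed

text \<open>The hypothesis d <= m absorbs the d^4 of the recurrence into m d^3.\<close>

lemma time_bounds:
  fixes d m :: nat
  assumes d: "1 \<le> d" and m: "d \<le> m"
  shows "(d + 1) ^ 4 \<le> 16 * (m * d ^ 3)" "(m + 1) * (d + 1) * (d + 1) \<le> 8 * (m * d ^ 3)"
    "(m + 1) * (1 + 1) * (d + 1) \<le> 8 * (m * d ^ 3)" "(d + 1) * (d + 1) * (1 + 1) \<le> 8 * (m * d ^ 3)"
    "m \<le> m * d ^ 3" "1 \<le> m * d ^ 3"
proof -
  have m1: "m + 1 \<le> 2 * m" and d1: "d + 1 \<le> 2 * d" "1 + 1 \<le> 2 * d" using d m by auto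
  have "(d + 1) ^ 4 \<le> (2 * d) ^ 4" by (rule power_mono[OF d1(1)]) simp
  also have "\<dots> = 16 * (d * d ^ 3)" by (simp add: power_mult_distrib flip: power_Suc)
  also have "\<dots> \<le> 16 * (m * d ^ 3)" using m by simp
  finally have a: "(d + 1) ^ 4 \<le> 16 * (m * d ^ 3)" .
  have dd: "d * d \<le> d ^ 3" "d \<le> d ^ 3" "1 \<le> d ^ 3"
    using d power_increasing[of 2 3 d] power_increasing[of 1 3 d] by (auto simp: power2_eq_square)
  have "(m + 1) * (d + 1) * (d + 1) \<le> (2 * m) * (2 * d) * (2 * d)"
    by (intro mult_le_mono m1 d1)
  also have "\<dots> = 8 * (m * (d * d))" by simp
  also have "\<dots> \<le> 8 * (m * d ^ 3)" using dd by simp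
  finally have b: "(m + 1) * (d + 1) * (d + 1) \<le> 8 * (m * d ^ 3)" .
  have c: "(m + 1) * (1 + 1) * (d + 1) \<le> 8 * (m * d ^ 3)"
    by (rule order_trans[OF _ b]) (use d in \<open>intro mult_le_mono, auto\<close>)
  have "(d + 1) * (d + 1) * (1 + 1) \<le> (m + 1) * (d + 1) * (d + 1)"
    using m d by (simp only: mult.commute[of _ "1 + 1"] mult.assoc[symmetric])
      (intro mult_le_mono, auto)
  then have e: "(d + 1) * (d + 1) * (1 + 1) \<le> 8 * (m * d ^ 3)" using b by (rule order_trans)
  have "m * 1 \<le> m * d ^ 3" using dd by (intro mult_le_mono2)
  then have f: "m \<le> m * d ^ 3" "1 \<le> m * d ^ 3" using m d by linarith+
  show "(d + 1) ^ 4 \<le> 16 * (m * d ^ 3)" "(m + 1) * (d + 1) * (d + 1) \<le> 8 * (m * d ^ 3)"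
    "(m + 1) * (1 + 1) * (d + 1) \<le> 8 * (m * d ^ 3)" "(d + 1) * (d + 1) * (1 + 1) \<le> 8 * (m * d ^ 3)"
    "m \<le> m * d ^ 3" "1 \<le> m * d ^ 3"
    by (fact a b c e f)+
qed

text \<open>The forms u_i^T G v_i take two passes through \<open>W\<close>, as a fill sums over one
  index only; this costs O(m d^2) for all i together.\<close>

definition Select_step :: com where
  "Select_step =
    Seq (NPut ''r'' (NConst 0) (NConst 0) (NSub (NSub (nvar ''k'') (NConst 1)) (nvar ''t'')))
   (Seq Faddeev
   (Seq (Fill ''W'' (nvar ''m'') Dim Dim (RMul (At ''U'' ''a'' ''c'') (At ''H'' ''c'' ''b'')))
   (Seq (Fill ''val'' (nvar ''m'') (NConst 1) Dim (RMul (At ''W'' ''a'' ''c'') (At ''v'' ''a'' ''c'')))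
   (Seq Argmax
   (Seq (NPut ''s'' (nvar ''t'') (NConst 0) (nvar ''best''))
   (Seq (Fill ''P'' Dim Dim (NConst 1)
          (RAdd (At ''B'' ''a'' ''b'') (RMul (At ''v'' ''best'' ''a'') (At ''U'' ''best'' ''b''))))
        (Fill ''B'' Dim Dim (NConst 1) (At ''P'' ''a'' ''b''))))))))"

lemma exec_Select_step:
  assumes d: "fst s ''d'' 0 0 = d" "d \<ge> 1" and m: "fst s ''m'' 0 0 = m" "d \<le> m"
    and k: "fst s ''k'' 0 0 = k" and l: "fst s ''t'' 0 0 = l"
    and B: "B = mat d d (\<lambda>(a, b). snd s ''B'' a b)"
  obtains t s' z where "exec Select_step s t s'" "t \<le> 30000 * (m * d ^ 3)"
    "frame {''a'', ''b'', ''c'', ''j'', ''r'', ''best'', ''i'', ''s''}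
       {''acc'', ''P'', ''q'', ''N'', ''H'', ''W'', ''val'', ''B''} s s'"
    "\<forall>i. fst s' ''s'' i 0 = (if i = l then z else fst s ''s'' i 0)" "z < m"
    "\<forall>i<m. gain d (k - 1 - l) B (snd s ''U'' i) (snd s ''v'' i) \<le>
       gain d (k - 1 - l) B (snd s ''U'' z) (snd s ''v'' z)"
    "\<forall>a<d. \<forall>b<d. snd s' ''B'' a b = snd s ''B'' a b + snd s ''v'' z a * snd s ''U'' z b"
proof -
  \<comment> \<open>Rounds are counted from 0, so this many samples remain after the present
    one.\<close>
  let ?r = "k - 1 - l"
  let ?G = "gain_mat d ?r B"
  let ?s1 = "set_nvar ''r'' ?r s"
  have 1: "exec (NPut ''r'' (NConst 0) (NConst 0) (NSub (NSub (nvar ''k'') (NConst 1)) (nvar ''t''))) s 12 ?s1"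
    using k l by (intro exec_NPutI) (simp_all add: set_nvar_def)
  have f1: "frame {''r''} {} s ?s1" by (simp add: frame_def set_nvar_def put_def)
  have r1: "fst ?s1 ''r'' 0 0 = ?r" by (simp add: set_nvar_def put_apply)
  have "fst ?s1 ''d'' 0 0 = d" "B = mat d d (\<lambda>(a, b). snd ?s1 ''B'' a b)"
    using f1 d by (simp_all add: frame_def B)
  from exec_Faddeev[OF this(1) d(2) r1 this(2)]
  obtain t2 s2 where 2: "exec Faddeev ?s1 t2 s2" "t2 \<le> 1000 * (d + 1) ^ 4"
    "frame {''a'', ''b'', ''c'', ''j''} {''acc'', ''P'', ''q'', ''N'', ''H''} ?s1 s2"
    "\<forall>a<d. \<forall>b<d. snd s2 ''H'' a b = ?G $$ (a, b)" .
  obtain t3 s3 where 3: "exec (Fill ''W'' (nvar ''m'') Dim Dim (RMul (At ''U'' ''a'' ''c'') (At ''H'' ''c'' ''b''))) s2 t3 s3"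
    "t3 \<le> 100 * ((m + 1) * (d + 1) * (d + 1))"
    "frame {''a'', ''b'', ''c''} {''acc'', ''W''} s2 s3"
    "\<forall>i<m. \<forall>b<d. snd s3 ''W'' i b = (\<Sum>c<d. snd s ''U'' i c * ?G $$ (c, b))"
    by (rule exec_FillE[where E = "\<lambda>i b c. snd s ''U'' i c * ?G $$ (c, b)", rotated -1],
        rule that, assumption+) (use f1 2(3,4) in \<open>simp_all add: frame_def d m\<close>)
  obtain t4 s4 where 4: "exec (Fill ''val'' (nvar ''m'') (NConst 1) Dim (RMul (At ''W'' ''a'' ''c'') (At ''v'' ''a'' ''c''))) s3 t4 s4"
    "t4 \<le> 100 * ((m + 1) * (1 + 1) * (d + 1))"
    "frame {''a'', ''b'', ''c''} {''acc'', ''val''} s3 s4"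
    "\<forall>i<m. \<forall>b<1. snd s4 ''val'' i b = (\<Sum>c<d. (\<Sum>a<d. snd s ''U'' i a * ?G $$ (a, c)) * snd s ''v'' i c)"
    by (rule exec_FillE[where E = "\<lambda>i b c. (\<Sum>a<d. snd s ''U'' i a * ?G $$ (a, c)) * snd s ''v'' i c", rotated -1],
        rule that, assumption+) (use f1 2(3) 3(3,4) in \<open>simp_all add: frame_def d m\<close>)
  have val: "snd s4 ''val'' i 0 = gain d ?r B (snd s ''U'' i) (snd s ''v'' i)" if "i < m" for i
    using 4(4) that unfolding gain_def
    by (subst sum.swap) (simp add: sum_distrib_right)
  have "fst s4 ''m'' 0 0 = m" "m \<ge> 1" using m d(2) f1 2(3) 3(3) 4(3) by (simp_all add: frame_def)
  from exec_Argmax[OF this] obtain t5 s5 z where 5: "exec Argmax s4 t5 s5" "t5 \<le> 40 * (m + 1)"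
    "frame {''best'', ''i''} {} s4 s5" "fst s5 ''best'' 0 0 = z" "z < m"
    "\<forall>i<m. snd s4 ''val'' i 0 \<le> snd s4 ''val'' z 0" .
  let ?s6 = "(put (fst s5) ''s'' l 0 z, snd s5)"
  have "fst s5 ''t'' 0 0 = l" using l f1 2(3) 3(3) 4(3) 5(3) by (simp add: frame_def)
  then have 6: "exec (NPut ''s'' (nvar ''t'') (NConst 0) (nvar ''best'')) s5 8 ?s6"
    using 5(4) by (intro exec_NPutI) simp_all
  have f6: "frame {''s''} {} s5 ?s6" by (simp add: frame_def put_def)
  obtain t7 s7 where 7: "exec (Fill ''P'' Dim Dim (NConst 1)
          (RAdd (At ''B'' ''a'' ''b'') (RMul (At ''v'' ''best'' ''a'') (At ''U'' ''best'' ''b'')))) ?s6 t7 s7"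
    "t7 \<le> 100 * ((d + 1) * (d + 1) * (1 + 1))"
    "frame {''a'', ''b'', ''c''} {''acc'', ''P''} ?s6 s7"
    "\<forall>a<d. \<forall>b<d. snd s7 ''P'' a b = snd s ''B'' a b + snd s ''v'' z a * snd s ''U'' z b"
    by (rule exec_FillE[where E = "\<lambda>a b c. snd s ''B'' a b + snd s ''v'' z a * snd s ''U'' z b", rotated -1],
        rule that, assumption+) (use f1 2(3) 3(3) 4(3) 5(3,4) f6 in \<open>simp_all add: frame_def d m\<close>)
  obtain t8 s8 where 8: "exec (Fill ''B'' Dim Dim (NConst 1) (At ''P'' ''a'' ''b'')) s7 t8 s8"
    "t8 \<le> 100 * ((d + 1) * (d + 1) * (1 + 1))"
    "frame {''a'', ''b'', ''c''} {''acc'', ''B''} s7 s8"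
    "\<forall>a<d. \<forall>b<d. snd s8 ''B'' a b = snd s ''B'' a b + snd s ''v'' z a * snd s ''U'' z b"
    by (rule exec_FillE[where E = "\<lambda>a b c. snd s ''B'' a b + snd s ''v'' z a * snd s ''U'' z b", rotated -1],
        rule that, assumption+) (use f1 2(3) 3(3) 4(3) 5(3) f6 7(3,4) in \<open>simp_all add: frame_def d m\<close>)
  show thesis
  proof (rule that)
    show "exec Select_step s (12 + (t2 + (t3 + (t4 + (t5 + (8 + (t7 + t8))))))) s8"
      unfolding Select_step_def
      by (rule exec.Seq[OF 1 exec.Seq[OF 2(1) exec.Seq[OF 3(1) exec.Seq[OF 4(1) exec.Seq[OF 5(1)
        exec.Seq[OF 6 exec.Seq[OF 7(1) 8(1)]]]]]]])
    show "frame {''a'', ''b'', ''c'', ''j'', ''r'', ''best'', ''i'', ''s''}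
       {''acc'', ''P'', ''q'', ''N'', ''H'', ''W'', ''val'', ''B''} s s8"
      using f1 2(3) 3(3) 4(3) 5(3) f6 7(3) 8(3) by (simp add: frame_def)
    have "fst s8 ''s'' = fst ?s6 ''s''" "fst s5 ''s'' = fst s ''s''"
      using f1 2(3) 3(3) 4(3) 5(3) 7(3) 8(3) by (simp_all add: frame_def)
    then show "\<forall>i. fst s8 ''s'' i 0 = (if i = l then z else fst s ''s'' i 0)"
      by (simp add: put_apply)
    show "\<forall>i<m. gain d ?r B (snd s ''U'' i) (snd s ''v'' i) \<le> gain d ?r B (snd s ''U'' z) (snd s ''v'' z)"
      using 5(5,6) val by simp
    \<comment> \<open>In units of m d^3, the recurrence takes 16000, the four fills 800 each and the
      rest 100.\<close>
    show "12 + (t2 + (t3 + (t4 + (t5 + (8 + (t7 + t8)))))) \<le> 30000 * (m * d ^ 3)"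
    proof -
      have a: "(d + 1) ^ 4 \<le> 16 * (m * d ^ 3)" using d(2) m(2) by (rule time_bounds)
      have b: "(m + 1) * (d + 1) * (d + 1) \<le> 8 * (m * d ^ 3)" using d(2) m(2) by (rule time_bounds)
      have c: "(m + 1) * (1 + 1) * (d + 1) \<le> 8 * (m * d ^ 3)" using d(2) m(2) by (rule time_bounds)
      have e: "(d + 1) * (d + 1) * (1 + 1) \<le> 8 * (m * d ^ 3)" using d(2) m(2) by (rule time_bounds)
      have f: "m \<le> m * d ^ 3" "1 \<le> m * d ^ 3" using d(2) m(2) by (rule time_bounds)+
      have "t2 \<le> 1000 * (16 * (m * d ^ 3))" using 2(2) mult_le_mono2[OF a] by (rule order_trans)
      moreover have "t3 \<le> 100 * (8 * (m * d ^ 3))" using 3(2) mult_le_mono2[OF b] by (rule order_trans)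
      moreover have "t4 \<le> 100 * (8 * (m * d ^ 3))" using 4(2) mult_le_mono2[OF c] by (rule order_trans)
      moreover have "t7 \<le> 100 * (8 * (m * d ^ 3))" using 7(2) mult_le_mono2[OF e] by (rule order_trans)
      moreover have "t8 \<le> 100 * (8 * (m * d ^ 3))" using 8(2) mult_le_mono2[OF e] by (rule order_trans)
      moreover have "t5 + 20 \<le> 100 * (m * d ^ 3)"
      proof -
        have "t5 + 20 \<le> 40 * m + 60" using 5(2) by simp
        also have "\<dots> \<le> 40 * (m * d ^ 3) + 60 * (m * d ^ 3)"
          using mult_le_mono2[OF f(1), of 40] mult_le_mono2[OF f(2), of 60] by (intro add_mono) simp_all
        finally show ?thesis by simp
      qed
      ultimately show ?thesis by simp
    qed
  qed (rule 5(5) 8(4))+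
qed

text \<open>With \<open>r = 0\<close> the Horner scheme returns the adjugate itself, so \<open>Faddeev\<close> also inverts \<open>X\<close>.
  For singular \<open>X\<close> the division by \<open>det = 0\<close> yields \<open>U = 0\<close>, which is harmless.\<close>

definition Prepare :: com where
  "Prepare =
    Seq (Fill ''B'' Dim Dim (nvar ''m'') (RMul (RGet ''x'' (nvar ''c'') (NConst 0))
          (RMul (At ''v'' ''c'' ''a'') (At ''v'' ''c'' ''b''))))
   (Seq Faddeev
   (Seq (Fill ''det'' (NConst 1) (NConst 1) Dim
          (RMul (RGet ''B'' (NConst 0) (nvar ''c'')) (RGet ''H'' (nvar ''c'') (NConst 0))))
   (Seq (Fill ''U'' (nvar ''m'') Dim Dim (RMul (At ''v'' ''a'' ''c'')
          (RDiv (RMul (OfNat (nvar ''k'')) (At ''H'' ''c'' ''b'')) (rvar ''det''))))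
        (Fill ''B'' Dim Dim (NConst 1) (OfNat (NConst 0))))))"

lemma exec_Prepare:
  assumes d: "fst s ''d'' 0 0 = d" "d \<ge> 1" and m: "fst s ''m'' 0 0 = m" "d \<le> m"
    and k: "fst s ''k'' 0 0 = k" and r: "fst s ''r'' 0 0 = 0"
    and v: "\<And>i a. i < m \<Longrightarrow> a < d \<Longrightarrow> snd s ''v'' i a = v i $ a"
    and x: "\<And>i. i < m \<Longrightarrow> snd s ''x'' i 0 = x $ i"
  obtains t s' where "exec Prepare s t s'" "t \<le> 30000 * (m * d ^ 3)"
    "frame {''a'', ''b'', ''c'', ''j''}
       {''acc'', ''P'', ''q'', ''N'', ''H'', ''B'', ''U'', ''det''} s s'"
    "\<forall>i<m. \<forall>b<d. snd s' ''U'' i b = dual_vec d m k v x i b"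
    "\<forall>a<d. \<forall>b<d. snd s' ''B'' a b = 0"
proof -
  let ?X = "weighted_gram d m v x"
  obtain t1 s1 where 1: "exec (Fill ''B'' Dim Dim (nvar ''m'') (RMul (RGet ''x'' (nvar ''c'') (NConst 0))
          (RMul (At ''v'' ''c'' ''a'') (At ''v'' ''c'' ''b'')))) s t1 s1"
    "t1 \<le> 100 * ((d + 1) * (d + 1) * (m + 1))"
    "frame {''a'', ''b'', ''c''} {''acc'', ''B''} s s1" "\<forall>a<d. \<forall>b<d. snd s1 ''B'' a b = ?X $$ (a, b)"
    by (rule exec_FillE[where E = "\<lambda>a b c. x $ c * (v c $ a * v c $ b)", rotated -1],
        rule that, assumption+) (simp_all add: frame_def d m v x weighted_gram_def)
  have "fst s1 ''d'' 0 0 = d" "fst s1 ''r'' 0 0 = 0" using 1(3) d r by (simp_all add: frame_def)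
  moreover have "?X = mat d d (\<lambda>(a, b). snd s1 ''B'' a b)"
    using 1(4) carrier_matD[OF weighted_gram_carrier[of d m v x]] by (intro eq_matI) auto
  ultimately obtain t2 s2 where 2: "exec Faddeev s1 t2 s2" "t2 \<le> 1000 * (d + 1) ^ 4"
    "frame {''a'', ''b'', ''c'', ''j''} {''acc'', ''P'', ''q'', ''N'', ''H''} s1 s2"
    "\<forall>a<d. \<forall>b<d. snd s2 ''H'' a b = gain_mat d 0 ?X $$ (a, b)"
    using d(2) by (elim exec_Faddeev)
  have H: "\<forall>a<d. \<forall>b<d. snd s2 ''H'' a b = adj_mat ?X $$ (a, b)"
    using 2(4) by (simp add: gain_mat_0)
  \<comment> \<open>The determinant is entry (0, 0) of X adj X, which exists as d >= 1.\<close>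
  have det: "(\<Sum>c<d. ?X $$ (0, c) * adj_mat ?X $$ (c, 0)) = det ?X"
  proof -
    have "det ?X = (?X * adj_mat ?X) $$ (0, 0)"
      using adj_mat(2)[OF weighted_gram_carrier[of d m v x]] d(2) by simp
    also have "\<dots> = (\<Sum>c<d. ?X $$ (0, c) * adj_mat ?X $$ (c, 0))"
      using d(2) carrier_matD[OF weighted_gram_carrier[of d m v x]]
      by (simp add: scalar_prod_def atLeast0LessThan)
    finally show ?thesis by simp
  qed
  obtain t3 s3 where 3: "exec (Fill ''det'' (NConst 1) (NConst 1) Dim
          (RMul (RGet ''B'' (NConst 0) (nvar ''c'')) (RGet ''H'' (nvar ''c'') (NConst 0)))) s2 t3 s3"
    "t3 \<le> 100 * ((1 + 1) * (1 + 1) * (d + 1))"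
    "frame {''a'', ''b'', ''c''} {''acc'', ''det''} s2 s3" "\<forall>a<1. \<forall>b<1. snd s3 ''det'' a b = det ?X"
    by (rule exec_FillE[where E = "\<lambda>a b c. ?X $$ (0, c) * adj_mat ?X $$ (c, 0)", rotated -1],
        rule that, assumption+) (use 1(3,4) 2(3) H d(2) in \<open>simp_all add: frame_def d(1) det\<close>)
  obtain t4 s4 where 4: "exec (Fill ''U'' (nvar ''m'') Dim Dim (RMul (At ''v'' ''a'' ''c'')
          (RDiv (RMul (OfNat (nvar ''k'')) (At ''H'' ''c'' ''b'')) (rvar ''det'')))) s3 t4 s4"
    "t4 \<le> 100 * ((m + 1) * (d + 1) * (d + 1))"
    "frame {''a'', ''b'', ''c''} {''acc'', ''U''} s3 s4"
    "\<forall>i<m. \<forall>b<d. snd s4 ''U'' i b = dual_vec d m k v x i b"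
    by (rule exec_FillE[where E = "\<lambda>i b c. v i $ c * (real k * adj_mat ?X $$ (c, b) / det ?X)", rotated -1],
        rule that, assumption+)
      (use 1(3) 2(3) 3(3,4) H in \<open>simp_all add: frame_def d m k v dual_vec_def Let_def\<close>)
  obtain t5 s5 where 5: "exec (Fill ''B'' Dim Dim (NConst 1) (OfNat (NConst 0))) s4 t5 s5"
    "t5 \<le> 100 * ((d + 1) * (d + 1) * (1 + 1))"
    "frame {''a'', ''b'', ''c''} {''acc'', ''B''} s4 s5" "\<forall>a<d. \<forall>b<d. snd s5 ''B'' a b = 0"
    by (rule exec_FillE[where E = "\<lambda>a b c. 0", rotated -1],
        rule that, assumption+) (use 1(3) 2(3) 3(3) 4(3) in \<open>simp_all add: frame_def d m\<close>)
  show thesis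
  proof (rule that)
    show "exec Prepare s (t1 + (t2 + (t3 + (t4 + t5)))) s5"
      unfolding Prepare_def
      by (rule exec.Seq[OF 1(1) exec.Seq[OF 2(1) exec.Seq[OF 3(1) exec.Seq[OF 4(1) 5(1)]]]])
    show "frame {''a'', ''b'', ''c'', ''j''}
       {''acc'', ''P'', ''q'', ''N'', ''H'', ''B'', ''U'', ''det''} s s5"
      using 1(3) 2(3) 3(3) 4(3) 5(3) by (simp add: frame_def)
    show "\<forall>i<m. \<forall>b<d. snd s5 ''U'' i b = dual_vec d m k v x i b"
      using 4(4) 5(3) by (simp add: frame_def)
    have b: "(m + 1) * (d + 1) * (d + 1) \<le> 8 * (m * d ^ 3)" using d(2) m(2) by (rule time_bounds)
    have b': "(d + 1) * (d + 1) * (m + 1) \<le> 8 * (m * d ^ 3)" using b by (simp only: mult_ac)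
    have c: "(1 + 1) * (1 + 1) * (d + 1) \<le> 8 * (m * d ^ 3)"
      by (rule order_trans[OF _ b]) (use d(2) m(2) in \<open>intro mult_le_mono, auto\<close>)
    have e: "(d + 1) * (d + 1) * (1 + 1) \<le> 8 * (m * d ^ 3)" using d(2) m(2) by (rule time_bounds)
    have a: "(d + 1) ^ 4 \<le> 16 * (m * d ^ 3)" using d(2) m(2) by (rule time_bounds)
    have "t2 \<le> 1000 * (16 * (m * d ^ 3))" using 2(2) mult_le_mono2[OF a] by (rule order_trans)
    moreover have "t1 \<le> 100 * (8 * (m * d ^ 3))" using 1(2) mult_le_mono2[OF b'] by (rule order_trans)
    moreover have "t3 \<le> 100 * (8 * (m * d ^ 3))" using 3(2) mult_le_mono2[OF c] by (rule order_trans)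
    moreover have "t4 \<le> 100 * (8 * (m * d ^ 3))" using 4(2) mult_le_mono2[OF b] by (rule order_trans)
    moreover have "t5 \<le> 100 * (8 * (m * d ^ 3))" using 5(2) mult_le_mono2[OF e] by (rule order_trans)
    ultimately show "t1 + (t2 + (t3 + (t4 + t5))) \<le> 30000 * (m * d ^ 3)" by linarith
  qed (rule 5(4))
qed

text \<open>If m < d then det X = 0, and the zeros in the untouched memory, k copies of index 0, are
  good enough. The early exit also avoids the cost d^4, which m d^3 would not absorb.\<close>

definition Rounding :: com where
  "Rounding = Cond (NLess (nvar ''m'') Dim) Skip (Seq Prepare (For ''t'' (nvar ''k'') Select_step))"

lemma exec_Rounding_few_vectors:
  assumes "m < d"
  shows "exec Rounding (rounding_input d m k v x) 9 (rounding_input d m k v x)"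
proof -
  let ?s = "rounding_input d m k v x"
  have "exec Rounding ?s (1 + bcost (NLess (nvar ''m'') Dim) + 1) ?s"
    unfolding Rounding_def
    by (intro exec.CondTrue exec.Skip) (use assms in \<open>simp add: rounding_input_def\<close>)
  moreover have "1 + bcost (NLess (nvar ''m'') Dim) + 1 = 9" by simp
  ultimately show ?thesis by metis
qed

lemma exec_Rounding:
  assumes d: "d \<ge> 1" "d \<le> m" and k: "k \<ge> 1" and u: "u = dual_vec d m k v x"
    and B: "\<And>f l. B f l = mat d d (\<lambda>(a, b). \<Sum>i<l. v (f i) $ a * u (f i) b)"
  obtains t s' f where "exec Rounding (rounding_input d m k v x) t s'"
    "t \<le> 200000 * (k * (m * d ^ 3))" "f = (\<lambda>l. fst s' ''s'' l 0)" "\<forall>l<k. f l < m"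
    "\<forall>l<k. \<forall>i<m. gain d (k - 1 - l) (B f l) (u i) (\<lambda>b. v i $ b) \<le>
      gain d (k - 1 - l) (B f l) (u (f l)) (\<lambda>b. v (f l) $ b)"
proof -
  define s where "s = rounding_input d m k v x"
  have s: "fst s ''d'' 0 0 = d" "fst s ''m'' 0 0 = m" "fst s ''k'' 0 0 = k" "fst s ''r'' 0 0 = 0"
    and sv: "\<And>i a. i < m \<Longrightarrow> a < d \<Longrightarrow> snd s ''v'' i a = v i $ a"
    and sx: "\<And>i. i < m \<Longrightarrow> snd s ''x'' i 0 = x $ i"
    by (simp_all add: s_def rounding_input_def)
  obtain t1 s1 where 1: "exec Prepare s t1 s1" "t1 \<le> 30000 * (m * d ^ 3)"
    "frame {''a'', ''b'', ''c'', ''j''} {''acc'', ''P'', ''q'', ''N'', ''H'', ''B'', ''U'', ''det''} s s1"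
    "\<forall>i<m. \<forall>b<d. snd s1 ''U'' i b = u i b" "\<forall>a<d. \<forall>b<d. snd s1 ''B'' a b = 0"
    using exec_Prepare[OF s(1) d(1) s(2) d(2) s(3,4) sv sx] unfolding u by metis
  define V where "V = {''a'', ''b'', ''c'', ''j'', ''r'', ''best'', ''i'', ''s'', ''t''}"
  define W where "W = {''acc'', ''P'', ''q'', ''N'', ''H'', ''W'', ''val'', ''B''}"
  define sel where "sel s' l = fst s' ''s'' l 0" for s' :: state and l
  define I where "I l s' \<longleftrightarrow> frame V W s1 s' \<and> (\<forall>i<l. sel s' i < m) \<and>
    (\<forall>a<d. \<forall>b<d. snd s' ''B'' a b = B (sel s') l $$ (a, b)) \<and>
    (\<forall>j<l. \<forall>i<m. gain d (k - 1 - j) (B (sel s') j) (u i) (\<lambda>b. v i $ b) \<le>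
      gain d (k - 1 - j) (B (sel s') j) (u (sel s' j)) (\<lambda>b. v (sel s' j) $ b))" for l s'
  \<comment> \<open>Only the choices before \<open>l\<close> matter, so recording a new choice
    preserves all earlier greedy inequalities.\<close>
  have B_cong: "B f l = B g l" if "\<And>i. i < l \<Longrightarrow> f i = g i" for f g l
    using that by (simp add: B)
  have I_set: "I l (set_nvar ''t'' n s')" if "I l s'" for l n s'
  proof -
    have "sel (set_nvar ''t'' n s') = sel s'" by (simp add: sel_def set_nvar_def put_apply fun_eq_iff)
    moreover have "snd (set_nvar ''t'' n s') = snd s'" by (simp add: set_nvar_def)
    moreover have "frame V W s1 (set_nvar ''t'' n s')"
      using that by (intro frame_set_nvar) (simp_all add: I_def V_def)
    ultimately show ?thesis using that by (simp add: I_def)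
  qed
  have "\<exists>t s'. exec (For ''t'' (nvar ''k'') Select_step) s1 t s' \<and>
      t \<le> (k + 1) * (30000 * (m * d ^ 3) + 13 + ncost (nvar ''k'')) \<and> I k s'"
  proof (rule exec_For[where I = I])
    have "I 0 s1" using 1(5) by (simp add: I_def B frame_def)
    then show "I 0 (set_nvar ''t'' 0 s1)" by (rule I_set)
  next
    fix l s2 assume l: "l < k" and I: "I l s2" and ls: "fst s2 ''t'' 0 0 = l"
    have fr: "frame V W s1 s2" using I by (simp add: I_def)
    have s2: "fst s2 ''d'' 0 0 = d" "fst s2 ''m'' 0 0 = m" "fst s2 ''k'' 0 0 = k"
      using fr 1(3) s by (simp_all add: frame_def V_def)
    have s2v: "snd s2 ''v'' i a = v i $ a" "snd s2 ''U'' i a = u i a" if "i < m" "a < d" for i a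
      using fr 1(3,4) sv that by (simp_all add: frame_def W_def)
    have Bs2: "B (sel s2) l = mat d d (\<lambda>(a, b). snd s2 ''B'' a b)"
      using I by (intro eq_matI) (auto simp: I_def B)
    from exec_Select_step[OF s2(1) d(1) s2(2) d(2) s2(3) ls Bs2]
    obtain t s3 z where 3: "exec Select_step s2 t s3" "t \<le> 30000 * (m * d ^ 3)"
      "frame {''a'', ''b'', ''c'', ''j'', ''r'', ''best'', ''i'', ''s''}
         {''acc'', ''P'', ''q'', ''N'', ''H'', ''W'', ''val'', ''B''} s2 s3"
      "\<forall>i. fst s3 ''s'' i 0 = (if i = l then z else fst s2 ''s'' i 0)" "z < m"
      "\<forall>i<m. gain d (k - 1 - l) (B (sel s2) l) (snd s2 ''U'' i) (snd s2 ''v'' i) \<le>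
         gain d (k - 1 - l) (B (sel s2) l) (snd s2 ''U'' z) (snd s2 ''v'' z)"
      "\<forall>a<d. \<forall>b<d. snd s3 ''B'' a b = snd s2 ''B'' a b + snd s2 ''v'' z a * snd s2 ''U'' z b" .
    have sel3: "sel s3 i = (if i = l then z else sel s2 i)" for i using 3(4) by (simp add: sel_def)
    have Beq: "B (sel s3) j = B (sel s2) j" if "j \<le> l" for j using that by (intro B_cong) (simp add: sel3)
    have "I (Suc l) s3"
      unfolding I_def
    proof (intro conjI allI impI)
      show "frame V W s1 s3" using fr 3(3) by (simp add: frame_def V_def W_def)
    next
      fix i assume "i < Suc l"
      then show "sel s3 i < m" using I 3(5) by (auto simp: I_def sel3 less_Suc_eq)
    next
      fix a b assume ab: "a < d" "b < d"
      have "snd s3 ''B'' a b = B (sel s3) l $$ (a, b) + v z $ a * u z b"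
        using ab I 3(5,7) Beq[of l] by (simp add: s2v I_def)
      also have "\<dots> = B (sel s3) (Suc l) $$ (a, b)" using ab by (simp add: B sel3)
      finally show "snd s3 ''B'' a b = B (sel s3) (Suc l) $$ (a, b)" .
    next
      fix j i assume j: "j < Suc l" and i: "i < m"
      show "gain d (k - 1 - j) (B (sel s3) j) (u i) (\<lambda>b. v i $ b) \<le>
          gain d (k - 1 - j) (B (sel s3) j) (u (sel s3 j)) (\<lambda>b. v (sel s3 j) $ b)"
      proof (cases "j = l")
        case True
        have "gain d (k - 1 - l) (B (sel s2) l) (snd s2 ''U'' i') (snd s2 ''v'' i') =
            gain d (k - 1 - l) (B (sel s2) l) (u i') (\<lambda>b. v i' $ b)" if "i' < m" for i'
          using that by (intro gain_cong) (simp_all add: s2v)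
        with 3(5,6) i True show ?thesis by (simp add: Beq sel3)
      next
        case False
        with I j i show ?thesis by (simp add: Beq sel3 I_def)
      qed
    qed
    then have "I (Suc l) (set_nvar ''t'' (Suc l) s3)" by (rule I_set)
    moreover have "fst s3 ''t'' 0 0 = l" using ls 3(3) by (simp add: frame_def)
    ultimately show "\<exists>t s'. exec Select_step s2 t s' \<and> t \<le> 30000 * (m * d ^ 3) \<and> fst s' ''t'' 0 0 = l \<and>
        I (Suc l) (set_nvar ''t'' (Suc l) s')" using 3(1,2) by blast
  next
    fix l s2 assume "I l s2"
    then show "nval (nvar ''k'') s2 = k" using 1(3) s by (simp add: I_def frame_def V_def)
  qed
  then obtain t2 s2 where 2: "exec (For ''t'' (nvar ''k'') Select_step) s1 t2 s2"
    "t2 \<le> (k + 1) * (30000 * (m * d ^ 3) + 13 + ncost (nvar ''k''))" "I k s2" by blast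
  show thesis
  proof (rule that[of _ _ "sel s2"])
    have "exec Rounding s (1 + bcost (NLess (nvar ''m'') Dim) + (t1 + t2)) s2"
      unfolding Rounding_def using s d by (intro exec.CondFalse exec.Seq[OF 1(1) 2(1)]) simp
    moreover have "1 + bcost (NLess (nvar ''m'') Dim) = 8" by simp
    ultimately show "exec Rounding (rounding_input d m k v x) (8 + (t1 + t2)) s2"
      unfolding s_def by metis
    show "8 + (t1 + t2) \<le> 200000 * (k * (m * d ^ 3))"
    proof -
      define Z where "Z = m * d ^ 3"
      have Z: "1 \<le> Z" unfolding Z_def using d by (rule time_bounds)
      \<comment> \<open>The extra loop round is absorbed by k + 1 <= 2 k.\<close>
      have "t2 \<le> (2 * k) * (30000 * Z + 16)"
        using 2(2) k by (intro order_trans[OF 2(2)] mult_le_mono) (simp_all add: Z_def)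
      also have "\<dots> \<le> (2 * k) * (30000 * Z + 16 * Z)" using Z by (intro mult_le_mono) auto
      also have "\<dots> \<le> 100000 * (k * Z)" by simp
      finally have "t2 \<le> 100000 * (k * Z)" .
      moreover have "Z \<le> k * Z" using k by simp
      ultimately show ?thesis using 1(2) Z unfolding Z_def[symmetric] by linarith
    qed
  qed (use 2(3) in \<open>simp_all add: I_def sel_def[abs_def]\<close>)
qed

section \<open>The approximation guarantee and the running time\<close>

theorem theorem1p2:
  shows "\<exists>(P :: com) (C :: real).
    \<forall>(d :: nat) (m :: nat) (k :: nat) (v :: nat \<Rightarrow> real vec) (x :: real vec).
      1 \<le> d \<and> d \<le> k \<and> (\<forall>i<m. v i \<in> carrier_vec d) \<and>
      relaxation_optimal d m k v x \<and> (\<Sum>i<m. x $ i) = real k \<longrightarrow>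
      (\<exists>t \<sigma>.
        exec P (rounding_input d m k v x) t \<sigma> \<and>
        (let X = weighted_gram d m v x;
             S = mset (rounding_output k \<sigma>);
             \<alpha> = real k * (fact (k - d) / fact k) powr (1 / real d)
         in S \<in> D_design_solutions m k \<and>
            det (multiset_gram d v S) \<ge> fact k / (fact (k - d) * real k ^ d) * det X \<and>
            D_objective d (multiset_gram d v S) \<le> ereal \<alpha> * D_objective d X \<and>
            D_objective d (multiset_gram d v S) \<le> ereal \<alpha> * D_design_opt d m k v) \<and>
        real t \<le> C * (real k * real m * real d powr (\<omega> + 1)))"
proof (rule exI[of _ Rounding], rule exI[of _ 200000], intro allI impI, elim conjE)
  fix d m k :: nat and v :: "nat \<Rightarrow> real vec" and x :: "real vec"
  assume d: "1 \<le> d" "d \<le> k" and opt: "relaxation_optimal d m k v x" and sum: "(\<Sum>i<m. x $ i) = real k"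
  have x: "x $ i \<ge> 0" if "i < m" for i
    using opt that by (simp add: relaxation_optimal_def relaxation_feasible_def)
  have m: "m \<ge> 1" using sum d by (cases m) auto
  define \<alpha> where "\<alpha> = real k * (fact (k - d) / fact k) powr (1 / real d)"
  have time: "real (k * (m * d ^ 3)) \<le> real k * real m * real d powr (\<omega> + 1)"
  proof -
    have "real d ^ 3 = real d powr 3" using d by (simp add: powr_numeral)
    \<comment> \<open>Since \<omega> >= 2, the exponent 3 coming from naive matrix products is at
      most \<omega> + 1.\<close>
    also have "\<dots> \<le> real d powr (\<omega> + 1)" using d matmul_exponent_ge_2 by (intro powr_mono) auto
    finally show ?thesis by (simp add: mult.assoc mult_left_mono)
  qed
  obtain t \<sigma> f where run: "exec Rounding (rounding_input d m k v x) t \<sigma>" "t \<le> 200000 * (k * (m * d ^ 3))"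
    and f: "f = (\<lambda>l. fst \<sigma> ''s'' l 0)" "\<forall>l<k. f l < m"
    and bound: "fact k / (fact (k - d) * real k ^ d) * det (weighted_gram d m v x)
      \<le> det (multiset_gram d v (mset (map f [0..<k])))"
  proof (cases "m < d")
    case True
    let ?s = "rounding_input d m k v x"
    let ?f = "\<lambda>l. fst ?s ''s'' l 0"
    \<comment> \<open>Unwritten memory is 0, and index 0 is valid because m >= 1.\<close>
    have f: "\<forall>l<k. ?f l < m" using m by (simp add: rounding_input_def)
    then have "set_mset (mset (map ?f [0..<k])) \<subseteq> {..<m}" by auto
    then have "det (multiset_gram d v (mset (map ?f [0..<k]))) \<ge> 0"
      by (subst multiset_gram_eq_weighted_gram) (auto intro: det_weighted_gram_nonneg)
    moreover have "1 \<le> k * (m * d ^ 3)" using m d by simp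
    then have "9 \<le> 200000 * (k * (m * d ^ 3))" by linarith
    ultimately show ?thesis
      using exec_Rounding_few_vectors[OF True, of k v x] f det_weighted_gram_few_vectors[OF True, of v x]
      by (intro that[of 9 ?s ?f]) simp_all
  next
    case False
    define u where "u = dual_vec d m k v x"
    define B where "B f l = mat d d (\<lambda>(a, b). \<Sum>i<l. v (f i) $ a * u (f i) b)" for f and l :: nat
    have "d \<le> m" "1 \<le> k" using False d by auto
    from exec_Rounding[OF d(1) this u_def B_def]
    obtain t s' f where r: "exec Rounding (rounding_input d m k v x) t s'"
      "t \<le> 200000 * (k * (m * d ^ 3))" "f = (\<lambda>l. fst s' ''s'' l 0)" "\<forall>l<k. f l < m"
      "\<forall>l<k. \<forall>i<m. gain d (k - 1 - l) (B f l) (u i) (\<lambda>b. v i $ b) \<le>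
        gain d (k - 1 - l) (B f l) (u (f l)) (\<lambda>b. v (f l) $ b)" .
    have "fact k / (fact (k - d) * real k ^ d) * det (weighted_gram d m v x)
      \<le> det (multiset_gram d v (mset (map f [0..<k])))"
      by (rule greedy_rounding_bound[OF d x sum _ u_def B_def]) (use r(4,5) in auto)
    with r show ?thesis by (intro that)
  qed
  define S where "S = mset (rounding_output k \<sigma>)"
  have S: "S = mset (map f [0..<k])" by (simp add: S_def rounding_output_def f(1))
  have sol: "S \<in> D_design_solutions m k" using f(2) by (auto simp: S D_design_solutions_def)
  have obj: "D_objective d (multiset_gram d v S) \<le> ereal \<alpha> * D_objective d (weighted_gram d m v x)"
    unfolding \<alpha>_def S by (rule D_objective_le[OF d bound])
  \<comment> \<open>The relaxation value bounds the discrete optimum from below.\<close>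
  also have "\<dots> \<le> ereal \<alpha> * D_design_opt d m k v"
    by (intro ereal_mult_left_mono relaxation_lower_bound[OF opt]) (simp add: \<alpha>_def)
  finally have obj': "D_objective d (multiset_gram d v S) \<le> ereal \<alpha> * D_design_opt d m k v" .
  have "real t \<le> 200000 * real (k * (m * d ^ 3))" using run(2) by (simp flip: of_nat_mult)
  also have "\<dots> \<le> 200000 * (real k * real m * real d powr (\<omega> + 1))" using time by simp
  finally show "\<exists>t \<sigma>. exec Rounding (rounding_input d m k v x) t \<sigma> \<and>
        (let X = weighted_gram d m v x;
             S = mset (rounding_output k \<sigma>);
             \<alpha> = real k * (fact (k - d) / fact k) powr (1 / real d)
         in S \<in> D_design_solutions m k \<and>
            det (multiset_gram d v S) \<ge> fact k / (fact (k - d) * real k ^ d) * det X \<and>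
            D_objective d (multiset_gram d v S) \<le> ereal \<alpha> * D_objective d X \<and>
            D_objective d (multiset_gram d v S) \<le> ereal \<alpha> * D_design_opt d m k v) \<and>
        real t \<le> 200000 * (real k * real m * real d powr (\<omega> + 1))"
    using run(1) sol bound obj obj' unfolding Let_def S_def[symmetric] \<alpha>_def[symmetric] S[symmetric]
    by (intro exI[of _ t] exI[of _ \<sigma>]) (simp add: S_def[symmetric])
qed

end
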